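(* Let $\Lambda=\Lambda_0\oplus\Lambda_1$ be a finite-dimensional real commutative superalgebra such that $\Lambda_0$ satisfies condition $(A_0)$ and $\Lambda_1$ satisfies condition $(A_1)$. Then the Cauchy–Riemann operator $d''$ on $\Lambda_0^n\times\Lambda_1^m$ admits as fundamental solution (i.e. $d''\Omega=[0]$ in the sense of currents) the form $$\Omega(x)=\frac{c}{\|x\|^N}\Big(\sum_{i=1}^n dY_i\wedge\sum_{j=1}^p(-1)^j(y_i^je_0+y_i^0e_j)\,\widehat{dy_i^0dy_i^j}+\sum_{i=1}^m\sum_{k=1}^r dZ_k(\theta_i)\wedge\sum_{\ell=s_k+1}^{s_{k+1}-1}(-1)^{\ell-1}(\theta_i^\ell e_0+\theta_i^{s_k}a_\ell)\,\widehat{d\theta_i^{s_k}d\theta_i^\ell}\Big),$$ where $N=n(p+1)+mq$ and $c=\big(N\,\mathrm{Vol}(B(0,1))\big)^{-1}$.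
   Context: A real commutative superalgebra (CSA) is an associative unital real algebra with a grading $\Lambda=\Lambda_0\oplus\Lambda_1$, $\Lambda_i\Lambda_j\subset\Lambda_{i+j \bmod 2}$, such that $ab=(-1)^{\sigma(a)\sigma(b)}ba$ for homogeneous $a,b$, where $\sigma(a)=i$ for $a\in\Lambda_i$. Condition $(A_0)$: there is a basis $(e_0=1,e_1,\dots,e_p)$ of $\Lambda_0$ with $\sum_{k=0}^p e_k^2=0$. Condition $(A_1)$: there are a basis $(\varepsilon_1,\dots,\varepsilon_q)$ of $\Lambda_1$, integers $1=s_1<s_2<\dots<s_r<s_{r+1}=q+1$ and elements $a_1,\dots,a_q\in\Lambda_0$ such that $\varepsilon_j=a_j\varepsilon_{s_k}$ whenever $s_k\le j<s_{k+1}$, $a_{s_1}=\dots=a_{s_r}=e_0$, and $\sum_{j=s_k}^{s_{k+1}-1}a_j^2=0$ for every $k=1,\dots,r$. Such bases and elements are fixed. A point of $\Lambda_0^n\times\Lambda_1^m$ is written $x=(y_1,\dots,y_n,\theta_1,\dots,\theta_m)$ with $y_i=\sum_{k=0}^p y_i^k e_k$, $\theta_i=\sum_{l=1}^q\theta_i^l\varepsilon_l$, where $y_i^k,\theta_i^l$ are real coordinates; $\|\cdot\|$ is the Euclidean norm in these $N$ coordinates and $\mathrm{Vol}(B(0,1))$ the volume of its unit ball. The space is oriented by the coordinates in the order $y_1^0,\dots,y_1^p,\dots,y_n^0,\dots,y_n^p,\theta_1^1,\dots,\theta_1^q,\dots,\theta_m^1,\dots,\theta_m^q$. Differential forms are forms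 in the real coordinates with coefficients in $\Lambda$, and $$d''\omega=\sum_{i=1}^n\sum_{j=1}^p dy_i^j\wedge\Big(\frac{\partial\omega}{\partial y_i^j}-e_j\frac{\partial\omega}{\partial y_i^0}\Big)+\sum_{i=1}^m\sum_{k=1}^r\sum_{t=s_k+1}^{s_{k+1}-1}d\theta_i^t\wedge\Big(\frac{\partial\omega}{\partial\theta_i^t}-a_t\frac{\partial\omega}{\partial\theta_i^{s_k}}\Big)$$ (derivatives act on the coefficients, in the sense of distributions for currents). $dY_i=\sum_{k=0}^p e_k\,dy_i^k$; $dZ_k(\theta_i)=\sum_{\ell=s_k}^{s_{k+1}-1}a_\ell\,d\theta_i^\ell$; $\widehat{dy_i^0dy_i^j}$ (resp. $\widehat{d\theta_i^{s_k}d\theta_i^\ell}$) is the wedge product, taken in the order $y_1^0,\dots,y_1^p,\dots,y_n^0,\dots,y_n^p,\theta_1^1,\dots,\theta_1^q,\dots,\theta_m^1,\dots,\theta_m^q$ of the coordinates, of the differentials of all $N$ real coordinates except $y_i^0,y_i^j$ (resp. except $\theta_i^{s_k},\theta_i^\ell$). $[0]$ is the evaluation current at $0$: $\langle[0],\varphi\rangle=\varphi(0)$ for test functions $\varphi$. The form $\Omega$ has locally integrable coefficients, and $d''\Omega=[0]$ means $(-1)^N\int\Omega\wedge d''\varphi=\varphi(0)$ for every $C^\infty$ compactly supported function $\varphi$ on $\Lambda_0^n\times\Lambda_1^m$.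
   Formalization: The sign $(-1)^{\ell-1}$ in the odd part of $\Omega$ is corrected to $(-1)^{\ell-s_k}$, since the printed form fails when some $s_k$ is even (and $m\ge1$); the printed formula is also proved when all $s_k$ are odd. *)

theory Defs
  imports "HOL-Analysis.Analysis" "HOL-Library.Function_Algebras"
begin

section \<open>Commutative superalgebras and the conditions on their bases\<close>

text \<open>The algebra is the whole type, with homogeneous parts \<open>\<Lambda> 0\<close> and \<open>\<Lambda> 1\<close>.\<close>

definition comm_superalgebra :: "(nat \<Rightarrow> 'a::real_algebra_1 set) \<Rightarrow> bool" where
  "comm_superalgebra \<Lambda> \<longleftrightarrow>
     subspace (\<Lambda> 0) \<and> subspace (\<Lambda> 1) \<and>
     \<Lambda> 0 \<inter> \<Lambda> 1 = {0} \<and> (\<forall>x. \<exists>u\<in>\<Lambda> 0. \<exists>v\<in>\<Lambda> 1. x = u + v) \<and>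
     (\<forall>i\<in>{0, 1}. \<forall>j\<in>{0, 1}. \<forall>u\<in>\<Lambda> i. \<forall>v\<in>\<Lambda> j.
        u * v \<in> \<Lambda> ((i + j) mod 2) \<and> u * v = (- 1) ^ (i * j) * (v * u))"

definition indexed_basis :: "(nat \<Rightarrow> 'a::real_vector) \<Rightarrow> nat set \<Rightarrow> 'a set \<Rightarrow> bool" where
  "indexed_basis f I V \<longleftrightarrow> inj_on f I \<and> independent (f ` I) \<and> span (f ` I) = V"

definition condition_A0 :: "(nat \<Rightarrow> 'a::real_algebra_1 set) \<Rightarrow> nat \<Rightarrow> (nat \<Rightarrow> 'a) \<Rightarrow> bool" where
  "condition_A0 \<Lambda> p e \<longleftrightarrow>
     indexed_basis e {0..p} (\<Lambda> 0) \<and> e 0 = 1 \<and> (\<Sum>k=0..p. (e k)\<^sup>2) = 0"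

text \<open>The case \<open>r = 0\<close> is possible exactly when \<open>q = 0\<close>, i.e. when the odd part vanishes.\<close>

definition condition_A1 ::
  "(nat \<Rightarrow> 'a::real_algebra_1 set) \<Rightarrow> (nat \<Rightarrow> 'a) \<Rightarrow> nat \<Rightarrow> (nat \<Rightarrow> 'a) \<Rightarrow> nat \<Rightarrow> (nat \<Rightarrow> nat) \<Rightarrow> (nat \<Rightarrow> 'a) \<Rightarrow> bool"
  where
  "condition_A1 \<Lambda> e q \<epsilon> r s a \<longleftrightarrow>
     indexed_basis \<epsilon> {1..q} (\<Lambda> 1) \<and>
     s 1 = 1 \<and> s (r + 1) = q + 1 \<and> (\<forall>k\<in>{1..r}. s k < s (k + 1)) \<and>
     (\<forall>j\<in>{1..q}. a j \<in> \<Lambda> 0) \<and>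
     (\<forall>k\<in>{1..r}. \<forall>j\<in>{s k..<s (k + 1)}. \<epsilon> j = a j * \<epsilon> (s k)) \<and>
     (\<forall>k\<in>{1..r}. a (s k) = e 0) \<and>
     (\<forall>k\<in>{1..r}. (\<Sum>j\<in>{s k..<s (k + 1)}. (a j)\<^sup>2) = 0)"

section \<open>Exterior forms with coefficients in the algebra\<close>

text \<open>
  The real coordinates are numbered \<open>0, \<dots>, N - 1\<close>. An exterior form is given by its
  coefficients: \<open>\<omega> I\<close> is the coefficient of the monomial of the \<open>dx \<mu>\<close>, \<open>\<mu> \<in> I\<close>, multiplied
  in increasing order. The \<open>dx \<mu>\<close> commute with the elements of the algebra. A differential
  form is a function from points to exterior forms.
\<close>

type_synonym 'a form = "nat set \<Rightarrow> 'a"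

definition dx :: "nat \<Rightarrow> 'a::real_algebra_1 form" where
  "dx \<mu> = (\<lambda>I. if I = {\<mu>} then 1 else 0)"

definition const_form :: "'a::real_algebra_1 \<Rightarrow> 'a form" where
  "const_form u = (\<lambda>I. if I = {} then u else 0)"

definition fscale :: "'a::real_algebra_1 \<Rightarrow> 'a form \<Rightarrow> 'a form" where
  "fscale u \<omega> = (\<lambda>I. u * \<omega> I)"

text \<open>The sign is that of the permutation sorting \<open>J\<close> followed by \<open>I - J\<close>.\<close>

definition wedge :: "'a::real_algebra_1 form \<Rightarrow> 'a form \<Rightarrow> 'a form" (infixr "\<and>\<^sub>f" 70) where
  "\<alpha> \<and>\<^sub>f \<beta> = (\<lambda>I. \<Sum>J\<in>Pow I.
     (- 1) ^ card {(\<mu>, \<nu>). \<mu> \<in> J \<and> \<nu> \<in> I - J \<and> \<nu> < \<mu>} * (\<alpha> J * \<beta> (I - J)))"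

definition dx_omit :: "nat \<Rightarrow> nat \<Rightarrow> nat \<Rightarrow> 'a::real_algebra_1 form" where
  "dx_omit N \<mu> \<nu> =
     foldr (\<lambda>\<kappa> \<omega>. dx \<kappa> \<and>\<^sub>f \<omega>) (filter (\<lambda>\<kappa>. \<kappa> \<noteq> \<mu> \<and> \<kappa> \<noteq> \<nu>) [0..<N]) (const_form 1)"

section \<open>Coordinates\<close>

text \<open>
  Points are identified with their \<open>N\<close> real coordinates, i.e. with the points of a Euclidean
  space \<open>'v\<close> whose standard basis is enumerated as \<open>b 0, \<dots>, b (N - 1)\<close>. In the order
  \<open>y\<^sub>1\<^sup>0, \<dots>, y\<^sub>1\<^sup>p, \<dots>, y\<^sub>n\<^sup>0, \<dots>, y\<^sub>n\<^sup>p, \<theta>\<^sub>1\<^sup>1, \<dots>, \<theta>\<^sub>1\<^sup>q, \<dots>, \<theta>\<^sub>m\<^sup>1, \<dots>, \<theta>\<^sub>m\<^sup>q\<close>, \<open>y_pos p i k\<close> is the position of the coordinate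
  \<open>y\<^sub>i\<^sup>k\<close> (\<open>1 \<le> i \<le> n\<close>, \<open>0 \<le> k \<le> p\<close>) and \<open>t_pos n p q i l\<close> that of \<open>\<theta>\<^sub>i\<^sup>l\<close> (\<open>1 \<le> i \<le> m\<close>, \<open>1 \<le> l \<le> q\<close>).
\<close>

definition num_coords :: "nat \<Rightarrow> nat \<Rightarrow> nat \<Rightarrow> nat \<Rightarrow> nat" where
  "num_coords n m p q = n * (p + 1) + m * q"

definition y_pos :: "nat \<Rightarrow> nat \<Rightarrow> nat \<Rightarrow> nat" where
  "y_pos p i k = (i - 1) * (p + 1) + k"

definition t_pos :: "nat \<Rightarrow> nat \<Rightarrow> nat \<Rightarrow> nat \<Rightarrow> nat \<Rightarrow> nat" where
  "t_pos n p q i l = n * (p + 1) + (i - 1) * q + (l - 1)"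

section \<open>The Cauchy--Riemann operator and its fundamental solutions\<close>

definition form_deriv ::
  "'v::euclidean_space \<Rightarrow> ('v \<Rightarrow> 'a::{real_algebra_1, euclidean_space} form) \<Rightarrow> 'v \<Rightarrow> 'a form" where
  "form_deriv v \<omega> x = (\<lambda>I. frechet_derivative (\<lambda>z. \<omega> z I) (at x) v)"

definition dbar ::
  "(nat \<Rightarrow> 'v::euclidean_space) \<Rightarrow> nat \<Rightarrow> nat \<Rightarrow> nat \<Rightarrow> (nat \<Rightarrow> 'a) \<Rightarrow> nat \<Rightarrow> nat \<Rightarrow> (nat \<Rightarrow> nat) \<Rightarrow> (nat \<Rightarrow> 'a)
     \<Rightarrow> ('v \<Rightarrow> 'a::{real_algebra_1, euclidean_space} form) \<Rightarrow> 'v \<Rightarrow> 'a form" where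
  "dbar b n m p e q r s a \<omega> x =
     (\<Sum>i=1..n. \<Sum>j=1..p. dx (y_pos p i j) \<and>\<^sub>f
        (form_deriv (b (y_pos p i j)) \<omega> x - fscale (e j) (form_deriv (b (y_pos p i 0)) \<omega> x)))
   + (\<Sum>i=1..m. \<Sum>k=1..r. \<Sum>t\<in>{s k + 1..<s (k + 1)}. dx (t_pos n p q i t) \<and>\<^sub>f
        (form_deriv (b (t_pos n p q i t)) \<omega> x
         - fscale (a t) (form_deriv (b (t_pos n p q i (s k))) \<omega> x)))"

fun Ck :: "nat \<Rightarrow> ('v::euclidean_space \<Rightarrow> 'a::real_normed_vector) \<Rightarrow> bool" where
  "Ck 0 f \<longleftrightarrow> continuous_on UNIV f"
| "Ck (Suc k) f \<longleftrightarrow> (\<forall>x. f differentiable (at x)) \<and>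
     (\<forall>v\<in>Basis. Ck k (\<lambda>x. frechet_derivative f (at x) v))"

definition test_function :: "('v::euclidean_space \<Rightarrow> 'a::real_normed_vector) \<Rightarrow> bool" where
  "test_function \<phi> \<longleftrightarrow> (\<forall>k. Ck k \<phi>) \<and> compact (closure {x. \<phi> x \<noteq> 0})"

text \<open>Integral of a form of top degree \<open>N\<close>, for the orientation given by the order of the coordinates.\<close>

definition form_integral ::
  "nat \<Rightarrow> ('v::euclidean_space \<Rightarrow> 'a::{real_algebra_1, euclidean_space} form) \<Rightarrow> 'a" where
  "form_integral N \<omega> = integral\<^sup>L lborel (\<lambda>x. \<omega> x {..<N})"

definition locally_integrable_form ::
  "('v::euclidean_space \<Rightarrow> 'a::{real_algebra_1, euclidean_space} form) \<Rightarrow> bool" where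
  "locally_integrable_form \<omega> \<longleftrightarrow> (\<forall>I K. compact K \<longrightarrow> set_integrable lborel K (\<lambda>x. \<omega> x I))"

definition fundamental_solution ::
  "(nat \<Rightarrow> 'v::euclidean_space) \<Rightarrow> nat \<Rightarrow> nat \<Rightarrow> nat \<Rightarrow> (nat \<Rightarrow> 'a) \<Rightarrow> nat \<Rightarrow> nat \<Rightarrow> (nat \<Rightarrow> nat) \<Rightarrow> (nat \<Rightarrow> 'a)
     \<Rightarrow> ('v \<Rightarrow> 'a::{real_algebra_1, euclidean_space} form) \<Rightarrow> bool" where
  "fundamental_solution b n m p e q r s a \<Omega> \<longleftrightarrow>
     locally_integrable_form \<Omega> \<and>
     (\<forall>\<phi>. test_function \<phi> \<longrightarrow>
        (- 1) ^ num_coords n m p q *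
          form_integral (num_coords n m p q)
            (\<lambda>x. \<Omega> x \<and>\<^sub>f dbar b n m p e q r s a (\<lambda>z. const_form (\<phi> z)) x)
        = \<phi> 0)"

section \<open>The kernel\<close>

definition dY :: "nat \<Rightarrow> (nat \<Rightarrow> 'a::real_algebra_1) \<Rightarrow> nat \<Rightarrow> 'a form" where
  "dY p e i = (\<Sum>k=0..p. fscale (e k) (dx (y_pos p i k)))"

definition dZ :: "nat \<Rightarrow> nat \<Rightarrow> nat \<Rightarrow> (nat \<Rightarrow> nat) \<Rightarrow> (nat \<Rightarrow> 'a::real_algebra_1) \<Rightarrow> nat \<Rightarrow> nat \<Rightarrow> 'a form" where
  "dZ n p q s a k i = (\<Sum>l\<in>{s k..<s (k + 1)}. fscale (a l) (dx (t_pos n p q i l)))"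

text \<open>
  The argument \<open>\<sigma>\<close> is the exponent of the sign in the odd part. Since
  \<open>d\<theta>\<^sub>i\<^sup>s \<and> (d\<theta>\<^sub>i\<^sup>s d\<theta>\<^sub>i\<^sup>l omitted) \<and> d\<theta>\<^sub>i\<^sup>l\<close> with \<open>s = s k\<close> is \<open>(-1)\<^sup>N\<^sup>-\<^sup>1\<^sup>-\<^sup>(\<^sup>l\<^sup>-\<^sup>s\<^sup>)\<close> times the volume form, the sign
  for which the kernel is a fundamental solution is \<open>(-1)\<^sup>l\<^sup>-\<^sup>s\<close>. This is \<open>(-1)\<^sup>l\<^sup>-\<^sup>1\<close> if all
  \<open>s k\<close> are odd, but not in general: the blocks of condition \<open>A1\<close> may have odd length, in which case some \<open>s k\<close> may be even.
\<close>

definition Omega ::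
  "(nat \<Rightarrow> 'v::euclidean_space) \<Rightarrow> nat \<Rightarrow> nat \<Rightarrow> nat \<Rightarrow> (nat \<Rightarrow> 'a) \<Rightarrow> nat \<Rightarrow> nat \<Rightarrow> (nat \<Rightarrow> nat) \<Rightarrow> (nat \<Rightarrow> 'a)
     \<Rightarrow> (nat \<Rightarrow> nat \<Rightarrow> nat) \<Rightarrow> 'v \<Rightarrow> 'a::real_algebra_1 form" where
  "Omega b n m p e q r s a \<sigma> x =
     (let N = num_coords n m p q;
          c = inverse (real N * measure lborel (ball (0::'v) 1));
          y = (\<lambda>i k. x \<bullet> b (y_pos p i k));
          \<theta> = (\<lambda>i l. x \<bullet> b (t_pos n p q i l))
      in fscale (of_real (c / norm x ^ N))
        ((\<Sum>i=1..n. dY p e i \<and>\<^sub>f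
            (\<Sum>j=1..p. fscale ((- 1) ^ j * (y i j *\<^sub>R e 0 + y i 0 *\<^sub>R e j))
               (dx_omit N (y_pos p i 0) (y_pos p i j))))
       + (\<Sum>i=1..m. \<Sum>k=1..r. dZ n p q s a k i \<and>\<^sub>f
            (\<Sum>l\<in>{s k + 1..<s (k + 1)}.
               fscale ((- 1) ^ \<sigma> k l * (\<theta> i l *\<^sub>R e 0 + \<theta> i (s k) *\<^sub>R a l))
                 (dx_omit N (t_pos n p q i (s k)) (t_pos n p q i l))))))"

end

(*
  The even coordinates of each y_i and the odd coordinates of each theta_i within a block
  s_k, ..., s_(k+1) - 1 play the same role: a block of real coordinates x_0, ..., x_L with
  coefficients u_0 = 1, ..., u_L such that u_0^2 + ... + u_L^2 = 0. For a test function phi, the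
  top coefficient of the wedge of the kernel with d'' phi is, up to the factor
  (-1)^(N-1) c / |x|^N, the sum over all blocks and j >= 1 of
    (x_j + x_0 u_j) (d_j phi - u_j d_0 phi).
  Since the squares u_j^2 with j >= 1 add up to -1, this is E phi + sum u_j (x_0 d_j - x_j d_0) phi,
  where E is the Euler field. The rotation fields x_0 d_j - x_j d_0 integrate to 0 against a radial
  function, and the integral of E phi / |x|^N is -N Vol(B(0,1)) phi(0): writing |x|^(-N) as the
  integral of N t^(-N-1) over t > |x| turns it into N times the integral over the unit ball of the
  derivatives of t -> phi(tx).
*)

theory Submission
  imports Defs
begin

section \<open>Integration against the radial kernel\<close>

text \<open>The kernel has size |x|^(1-N) near the origin, so it is locally integrable, but its
  derivatives have size |x|^(-N), and integration by parts across the origin is not directly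
  available. The two kinds of fields get round this differently. For the Euler field, the factor 1/t
  left by rescaling is cancelled by linearity of the derivative in its direction, so that only the
  one-dimensional fundamental theorem on rays is needed. For the rotation fields, the weight is
  replaced by a power of |x|^2 + eps, which is smooth and still radial; integration by parts is then
  legitimate, and eps tends to 0 under dominated convergence. The constant N Vol(B(0,1)) is the area
  of the unit sphere; here it arises as the factor N times the volume of the ball. The minus sign of
  the Euler integral comes from phi vanishing at the far end of each ray; it turns (-1)^(N-1) into
  (-1)^N, which the prefactor in the notion of fundamental solution cancels.\<close>

lemma integrable_scaleR_right_iff:
  fixes f :: "'x \<Rightarrow> 'b::{banach, second_countable_topology}"
  assumes "c \<noteq> 0"
  shows "integrable M (\<lambda>x. c *\<^sub>R f x) \<longleftrightarrow> integrable M f"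
  using integrable_scaleR_right[of "inverse c" M "\<lambda>x. c *\<^sub>R f x"] assms by auto

lemma lborel_integral_scaleR:
  fixes f :: "'v::euclidean_space \<Rightarrow> 'b::euclidean_space"
  assumes [measurable]: "f \<in> borel_measurable borel" and t: "t > 0"
  shows "integrable lborel f \<longleftrightarrow> integrable lborel (\<lambda>x. f (t *\<^sub>R x))"
    and "integral\<^sup>L lborel f = t ^ DIM('v) *\<^sub>R (\<integral>x. f (t *\<^sub>R x) \<partial>lborel)"
proof -
  have eq: "lborel = density (distr lborel borel (\<lambda>x::'v. t *\<^sub>R x)) (\<lambda>_. ennreal (t ^ DIM('v)))"
    using lborel_affine[of t "0::'v"] t by (simp add: ennreal_power)
  show "integrable lborel f \<longleftrightarrow> integrable lborel (\<lambda>x. f (t *\<^sub>R x))"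
    using t by (subst eq, subst integrable_density) (simp_all add: integrable_distr_eq integrable_scaleR_right_iff)
  show "integral\<^sup>L lborel f = t ^ DIM('v) *\<^sub>R (\<integral>x. f (t *\<^sub>R x) \<partial>lborel)"
    using t by (subst eq, subst integral_density) (auto simp: integral_distr)
qed

text \<open>The primitive \<open>- (1 / t ^ N)\<close> vanishes at infinity because
  \<open>0 < N\<close>. This supplies the representation of the weight as an integral over
  \<open>t\<close>.\<close>

lemma has_bochner_integral_inverse_power_tail:
  fixes \<rho> :: real
  assumes "\<rho> > 0" "0 < N"
  shows "has_bochner_integral lborel (\<lambda>t. if \<rho> < t then real N / t ^ Suc N else 0) (1 / \<rho> ^ N)"
proof (rule has_bochner_integral_nn_integral)
  have "(\<integral>\<^sup>+t. ennreal (if \<rho> < t then real N / t ^ Suc N else 0) \<partial>lborel)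
      = (\<integral>\<^sup>+t. ennreal (real N / t ^ Suc N) * indicator {\<rho>..} t \<partial>lborel)"
    using AE_lborel_singleton[of \<rho>] by (intro nn_integral_cong_AE) (auto split: split_indicator)
  also have "\<dots> = ennreal (0 - (- (1 / \<rho> ^ N)))"
  proof (rule nn_integral_FTC_atLeast)
    show "((\<lambda>t. - (1 / t ^ N)) has_real_derivative real N / x ^ Suc N) (at x)" if "\<rho> \<le> x" for x
      using that assms
      by (auto intro!: derivative_eq_intros simp: field_simps simp flip: power_Suc power_add)
    have "LIM t at_top. (t::real) ^ N :> at_top"
      using assms by (intro filterlim_pow_at_top filterlim_ident)
    then have "((\<lambda>t::real. 1 / t ^ N) \<longlongrightarrow> 0) at_top"
      by (intro tendsto_divide_0[OF tendsto_const] filterlim_at_top_imp_at_infinity)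
    from tendsto_minus[OF this] show "((\<lambda>t::real. - (1 / t ^ N)) \<longlongrightarrow> 0) at_top"
      by simp
  qed (use assms in auto)
  finally show "(\<integral>\<^sup>+t. ennreal (if \<rho> < t then real N / t ^ Suc N else 0) \<partial>lborel) = ennreal (1 / \<rho> ^ N)"
    by simp
qed (use assms in auto)

text \<open>Write \<open>\<parallel>x\<parallel>\<^sup>-\<^sup>N\<close> as the integral of \<open>N t\<^sup>-\<^sup>N\<^sup>-\<^sup>1\<close> over \<open>t > \<parallel>x\<parallel>\<close>, exchange the integrals, and rescale the
  ball of radius \<open>t\<close> to the unit ball.\<close>
lemma radial_kernel_integral:
  fixes f :: "'v::euclidean_space \<Rightarrow> 'b::euclidean_space"
  assumes [measurable]: "f \<in> borel_measurable borel"
    and bound: "\<And>x. norm (f x) \<le> C * norm x"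
    and supp: "\<And>x. norm x > R \<Longrightarrow> f x = 0"
  shows "integrable lborel (\<lambda>x. f x /\<^sub>R norm x ^ DIM('v))"
    and "(\<integral>x. f x /\<^sub>R norm x ^ DIM('v) \<partial>lborel)
      = (\<integral>x. \<integral>t. (if 0 < t \<and> norm x < 1 then (real DIM('v) / t) *\<^sub>R f (t *\<^sub>R x) else 0) \<partial>lborel \<partial>lborel)"
proof -
  define N where "N = DIM('v)"
  have N: "N > 0" by (simp add: N_def)
  \<comment> \<open>\<open>H\<close> is the integrand on the pairs with \<open>norm x < t\<close>.
    \<open>K\<close> is its pullback under x -> t x, including the Jacobian \<open>t ^ N\<close>,
    which lowers \<open>N / t ^ Suc N\<close> to \<open>N / t\<close>.\<close>
  define H where "H = (\<lambda>(t, x). if norm x < t then (real N / t ^ Suc N) *\<^sub>R f x else 0)"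
  define K where "K = (\<lambda>(t, x). if 0 < t \<and> norm x < 1 then (real N / t) *\<^sub>R f (t *\<^sub>R x) else 0)"
  \<comment> \<open>The linear bound forces \<open>f 0 = 0\<close>, so both sides of the
    representation of \<open>f x /\<^sub>R norm x ^ N\<close> vanish at the origin.\<close>
  have f0: "f 0 = 0" using bound[of 0] by simp
  have C: "C \<ge> 0"
  proof -
    obtain u :: 'v where "u \<in> Basis" using nonempty_Basis by blast
    then have "norm u = 1" by simp
    with bound[of u] show ?thesis
      by (metis mult.right_neutral norm_ge_zero order_trans)
  qed
  have [measurable]: "H \<in> borel_measurable (lborel \<Otimes>\<^sub>M lborel)"
    unfolding H_def by measurable
  have [measurable]: "K \<in> borel_measurable (lborel \<Otimes>\<^sub>M lborel)"
    unfolding K_def by measurable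
  have HK: "K (t, x) = t ^ N *\<^sub>R H (t, t *\<^sub>R x)" if "t > 0" for t x
    using that by (auto simp: H_def K_def field_simps)
  have triv: "K (t, x) = 0" "H (t, x) = 0" if "\<not> t > 0" for t x
    using that norm_ge_zero[of x] by (auto simp: K_def H_def simp del: norm_ge_zero)
  \<comment> \<open>The integrand is nonzero only for \<open>t * norm x \<le> R\<close>, an interval
    of length at most |R| / \<open>norm x\<close>, and is bounded there by
    \<open>N * C * norm x\<close>; the factors \<open>norm x\<close> cancel. The absolute value
    allows for a negative \<open>R\<close>.\<close>
  have inner_bound: "(\<integral>\<^sup>+t. ennreal (norm (K (t, x))) \<partial>lborel)
      \<le> ennreal (N * C * \<bar>R\<bar>) * indicator (ball 0 1) x" for x
  proof (cases "x = 0 \<or> \<not> norm x < 1")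
    case True
    then have "K (t, x) = 0" for t
      by (auto simp: K_def f0)
    then show ?thesis by simp
  next
    case False
    have "(\<integral>\<^sup>+t. ennreal (norm (K (t, x))) \<partial>lborel)
      \<le> (\<integral>\<^sup>+t. ennreal (N * C * norm x) * indicator {0..\<bar>R\<bar> / norm x} t \<partial>lborel)"
    proof (rule nn_integral_mono)
      fix t :: real
      show "ennreal (norm (K (t, x))) \<le> ennreal (N * C * norm x) * indicator {0..\<bar>R\<bar> / norm x} t"
      proof (cases "t > 0 \<and> t * norm x \<le> R")
        case True
        then have "t \<in> {0..\<bar>R\<bar> / norm x}"
          using False by (auto simp: field_simps)
        moreover have "norm (K (t, x)) \<le> N * C * norm x"
        proof -
          have "norm (K (t, x)) \<le> real N / t * norm (f (t *\<^sub>R x))"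
            using True by (auto simp: K_def)
          also have "\<dots> \<le> real N / t * (C * norm (t *\<^sub>R x))"
            using True by (intro mult_left_mono bound) auto
          also have "\<dots> = N * C * norm x" using True by simp
          finally show ?thesis .
        qed
        ultimately show ?thesis by (simp add: ennreal_leI)
      next
        case False
        then have "K (t, x) = 0"
          using supp[of "t *\<^sub>R x"] by (auto simp: K_def)
        then show ?thesis by simp
      qed
    qed
    also have "\<dots> = ennreal (N * C * norm x) * ennreal (\<bar>R\<bar> / norm x)"
      by (subst nn_integral_cmult_indicator) auto
    also have "\<dots> = ennreal (N * C * \<bar>R\<bar>)"
      using C False by (subst ennreal_mult[symmetric]) auto
    finally show ?thesis using False by simp
  qed
  \<comment> \<open>Integrability is proved for \<open>K\<close>, whose inner integrals are
    uniformly bounded over the unit ball, and then transferred to \<open>H\<close>: for each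
    \<open>t\<close> the slices of \<open>H\<close> and \<open>K\<close> have equal integrals, also
    after taking norms.\<close>
  have K: "integrable (lborel \<Otimes>\<^sub>M lborel) K"
  proof (rule integrableI_bounded)
    have "(\<integral>\<^sup>+p. ennreal (norm (K p)) \<partial>(lborel \<Otimes>\<^sub>M lborel))
        = (\<integral>\<^sup>+x. \<integral>\<^sup>+t. ennreal (norm (K (t, x))) \<partial>lborel \<partial>lborel)"
      by (rule lborel_pair.nn_integral_snd[symmetric]) measurable
    also have "\<dots> \<le> (\<integral>\<^sup>+x. ennreal (N * C * \<bar>R\<bar>) * indicator (ball 0 1) (x::'v) \<partial>lborel)"
      by (intro nn_integral_mono inner_bound)
    also have "\<dots> = ennreal (N * C * \<bar>R\<bar>) * emeasure lborel (ball (0::'v) 1)"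
      by (rule nn_integral_cmult_indicator) simp
    also have "\<dots> < \<infinity>"
      using emeasure_lborel_ball_finite[of "0::'v" 1] by (simp add: ennreal_mult_less_top)
    finally show "(\<integral>\<^sup>+p. ennreal (norm (K p)) \<partial>(lborel \<Otimes>\<^sub>M lborel)) < \<infinity>" .
  qed simp
  have norm_HK: "(\<integral>x. norm (H (t, x)) \<partial>lborel) = (\<integral>x. norm (K (t, x)) \<partial>lborel)" for t
  proof (cases "t > 0")
    case True
    have "(\<integral>x. norm (H (t, x)) \<partial>lborel) = t ^ N *\<^sub>R (\<integral>x. norm (H (t, t *\<^sub>R x)) \<partial>lborel)"
      unfolding N_def by (rule lborel_integral_scaleR(2)[OF _ True]) measurable
    also have "\<dots> = (\<integral>x. norm (K (t, x)) \<partial>lborel)"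
      using True by (simp add: HK flip: integral_mult_right_zero)
    finally show ?thesis .
  qed (simp add: triv)
  have int_HK: "(\<integral>x. H (t, x) \<partial>lborel) = (\<integral>x. K (t, x) \<partial>lborel)" for t
  proof (cases "t > 0")
    case True
    have "(\<integral>x. H (t, x) \<partial>lborel) = t ^ N *\<^sub>R (\<integral>x. H (t, t *\<^sub>R x) \<partial>lborel)"
      unfolding N_def by (rule lborel_integral_scaleR(2)[OF _ True]) measurable
    also have "\<dots> = (\<integral>x. K (t, x) \<partial>lborel)"
      using True by (simp add: HK)
    finally show ?thesis .
  qed (simp add: triv)
  have H: "integrable (lborel \<Otimes>\<^sub>M lborel) H"
  proof (rule lborel_pair.Fubini_integrable)
    show "integrable lborel (\<lambda>t. \<integral>x. norm (H (t, x)) \<partial>lborel)"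
      unfolding norm_HK using lborel_pair.integrable_fst'[OF integrable_norm[OF K]] by simp
    show "AE t in lborel. integrable lborel (\<lambda>x. H (t, x))"
      using lborel_pair.AE_integrable_fst'[OF K]
    proof eventually_elim
      case (elim t)
      show ?case
      proof (cases "t > 0")
        case True
        with elim have "integrable lborel (\<lambda>x. H (t, t *\<^sub>R x))"
          by (simp add: HK integrable_scaleR_right_iff)
        then show ?thesis
          by (subst lborel_integral_scaleR(1)[OF _ True]) measurable
      qed (simp add: triv)
    qed
  qed simp
  have inner: "(\<integral>t. H (t, x) \<partial>lborel) = f x /\<^sub>R norm x ^ N" for x
  proof (cases "x = 0")
    case True
    then show ?thesis by (simp add: H_def f0 if_distrib cong: if_cong)
  next
    case False
    then have "has_bochner_integral lborel (\<lambda>t. (if norm x < t then real N / t ^ Suc N else 0) *\<^sub>R f x)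
        ((1 / norm x ^ N) *\<^sub>R f x)"
      by (intro has_bochner_integral_scaleR_left has_bochner_integral_inverse_power_tail N) auto
    then show ?thesis
      by (auto dest!: has_bochner_integral_integral_eq simp: H_def inverse_eq_divide
          if_distrib[of "\<lambda>c. c *\<^sub>R f x"] cong: if_cong)
  qed
  have H': "integrable (lborel \<Otimes>\<^sub>M lborel) (case_prod (curry H))"
    and K': "integrable (lborel \<Otimes>\<^sub>M lborel) (case_prod (curry K))"
    using H K by auto
  show "integrable lborel (\<lambda>x. f x /\<^sub>R norm x ^ DIM('v))"
    using lborel_pair.integrable_snd[OF H'] by (simp add: inner N_def)
  have "(\<integral>x. f x /\<^sub>R norm x ^ N \<partial>lborel) = (\<integral>x. \<integral>t. curry H t x \<partial>lborel \<partial>lborel)"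
    by (simp add: inner)
  also have "\<dots> = (\<integral>t. \<integral>x. curry H t x \<partial>lborel \<partial>lborel)"
    by (rule lborel_pair.Fubini_integral[OF H'])
  also have "\<dots> = (\<integral>t. \<integral>x. curry K t x \<partial>lborel \<partial>lborel)"
    by (simp add: int_HK)
  also have "\<dots> = (\<integral>x. \<integral>t. curry K t x \<partial>lborel \<partial>lborel)"
    by (rule lborel_pair.Fubini_integral[OF K', symmetric])
  finally show "(\<integral>x. f x /\<^sub>R norm x ^ DIM('v) \<partial>lborel)
      = (\<integral>x. \<integral>t. (if 0 < t \<and> norm x < 1 then (real DIM('v) / t) *\<^sub>R f (t *\<^sub>R x) else 0) \<partial>lborel \<partial>lborel)"
    unfolding K_def curry_conv case_prod_conv N_def .
qed

section \<open>Compactly supported functions of class C1\<close>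

lemma linear_euclidean_expand:
  fixes f :: "'v::euclidean_space \<Rightarrow> 'b::real_vector"
  assumes "linear f"
  shows "f v = (\<Sum>u\<in>Basis. (v \<bullet> u) *\<^sub>R f u)"
proof -
  have "f v = f (\<Sum>u\<in>Basis. (v \<bullet> u) *\<^sub>R u)"
    by (simp add: euclidean_representation)
  then show ?thesis
    by (simp add: linear_sum[OF assms] linear_cmul[OF assms])
qed

text \<open>The derivative is a parameter of its own so that the locale also applies to products of
  \<open>\<phi>\<close> with weights, whose derivative is given by the product rule. A negative
  \<open>R\<close> is allowed and forces \<open>\<phi>\<close> to vanish.\<close>

locale compactly_supported_C1 =
  fixes \<phi> :: "'v::euclidean_space \<Rightarrow> 'b::euclidean_space" and \<phi>' :: "'v \<Rightarrow> 'v \<Rightarrow> 'b" and R :: real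
  assumes has_derivative: "\<And>x. (\<phi> has_derivative \<phi>' x) (at x)"
    and continuous_derivative: "\<And>v. continuous_on UNIV (\<lambda>x. \<phi>' x v)"
    and support: "\<And>x. norm x > R \<Longrightarrow> \<phi> x = 0"
begin

lemma linear_derivative: "linear (\<phi>' x)"
  using has_derivative by (rule has_derivative_linear)

lemma continuous: "continuous_on UNIV \<phi>"
  using has_derivative has_derivative_continuous by (blast intro: continuous_at_imp_continuous_on)

text \<open>The exterior of the closed ball is open, so near such a point \<open>\<phi>\<close>
  coincides with the zero function, and derivatives are unique.\<close>

lemma support_derivative:
  assumes "norm x > R"
  shows "\<phi>' x v = 0"
proof -
  have "open {y::'v. norm y > R}"
    by (intro open_Collect_less continuous_intros)
  with has_derivative[of x] have "((\<lambda>_. 0) has_derivative \<phi>' x) (at x)"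
    by (rule has_derivative_transform_within_open) (use assms support in auto)
  then have "\<phi>' x = (\<lambda>_. 0)"
    by (rule has_derivative_unique) simp
  then show ?thesis by simp
qed

lemma derivative_expand: "\<phi>' x v = (\<Sum>u\<in>Basis. (v \<bullet> u) *\<^sub>R \<phi>' x u)"
  using linear_derivative by (rule linear_euclidean_expand)

text \<open>Expanding the direction in the standard basis reduces the claim to fixed directions. The
  Euler field requires it: there the derivative is taken in a direction that moves with the
  point.\<close>

lemma continuous_derivative_along:
  assumes "continuous_on S f" "continuous_on S g"
  shows "continuous_on S (\<lambda>x. \<phi>' (f x) (g x))"
proof -
  have "continuous_on S (\<lambda>x. \<phi>' (f x) u)" for u
    using continuous_on_compose2[OF continuous_derivative assms(1)] by simp
  then show ?thesis
    by (subst derivative_expand) (intro continuous_intros assms)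
qed

text \<open>Compactness of the ball bounds the derivative in each basis direction, and the sum of
  these bounds serves all directions. \<open>C\<close> is later both a Lipschitz constant and the
  growth constant in \<open>radial_kernel_integral\<close>.\<close>

lemma derivative_bound:
  obtains C where "C \<ge> 0" "\<And>x v. norm (\<phi>' x v) \<le> C * norm v"
proof -
  have "\<exists>B. \<forall>x. norm (\<phi>' x u) \<le> B" for u
  proof -
    have "compact ((\<lambda>x. \<phi>' x u) ` cball 0 R)"
      by (intro compact_continuous_image continuous_on_subset[OF continuous_derivative]) auto
    then obtain B where B: "\<And>x. norm x \<le> R \<Longrightarrow> norm (\<phi>' x u) \<le> B"
      by (force dest!: compact_imp_bounded simp: bounded_iff)
    \<comment> \<open>\<open>max 0 B\<close> also covers the points outside the ball, where the
      derivative is \<open>0\<close>; if the ball is empty, \<open>B\<close> itself may be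
      negative.\<close>
    have "norm (\<phi>' x u) \<le> max 0 B" for x
      using B[of x] support_derivative[of x u] by (cases "norm x \<le> R") auto
    then show ?thesis by blast
  qed
  then obtain B where B: "\<And>x u. norm (\<phi>' x u) \<le> B u" by metis
  have B0: "B u \<ge> 0" for u using B[of 0 u] norm_ge_zero order_trans by blast
  show thesis
  proof
    show "(\<Sum>u\<in>Basis. B u) \<ge> 0" by (intro sum_nonneg B0)
    show "norm (\<phi>' x v) \<le> (\<Sum>u\<in>Basis. B u) * norm v" for x v
    proof -
      have "norm (\<phi>' x v) \<le> (\<Sum>u\<in>Basis. norm ((v \<bullet> u) *\<^sub>R \<phi>' x u))"
        by (subst derivative_expand) (rule norm_sum)
      also have "\<dots> \<le> (\<Sum>u\<in>Basis. B u * norm v)"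
      proof (rule sum_mono)
        fix u :: 'v assume "u \<in> Basis"
        then have "\<bar>v \<bullet> u\<bar> * norm (\<phi>' x u) \<le> norm v * B u"
          by (intro mult_mono B Basis_le_norm) auto
        then show "norm ((v \<bullet> u) *\<^sub>R \<phi>' x u) \<le> B u * norm v" by (simp add: mult.commute)
      qed
      finally show ?thesis by (simp add: sum_distrib_right)
    qed
  qed
qed

lemma integrable_if_supported:
  fixes f :: "'v \<Rightarrow> 'c::euclidean_space"
  assumes "continuous_on UNIV f" "\<And>x. norm x > R \<Longrightarrow> f x = 0"
  shows "integrable lborel f"
proof -
  have "integrable lborel (\<lambda>x. indicator (cball 0 R) x *\<^sub>R f x)"
    by (rule borel_integrable_compact) (auto intro: continuous_on_subset[OF assms(1)])
  also have "(\<lambda>x. indicator (cball 0 R) x *\<^sub>R f x) = f"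
    using assms(2) by (auto split: split_indicator simp: not_le)
  finally show ?thesis .
qed

lemma integrable_derivative: "integrable lborel (\<lambda>x. \<phi>' x v)"
  by (intro integrable_if_supported continuous_derivative support_derivative)

lemma integral_translate: "(\<integral>x. \<phi> (x + v) \<partial>lborel) = (\<integral>x. \<phi> x \<partial>lborel)"
proof -
  have [measurable]: "\<phi> \<in> borel_measurable borel"
    by (intro borel_measurable_continuous_onI continuous)
  show ?thesis
    by (subst (2) lborel_distr_plus[symmetric, of v]) (simp add: integral_distr add.commute)
qed

text \<open>The difference quotients in direction \<open>v\<close> have integral \<open>0\<close> by translation invariance.\<close>
lemma integral_derivative: "(\<integral>x. \<phi>' x v \<partial>lborel) = 0"
proof -
  obtain C where C: "C \<ge> 0" "\<And>x v. norm (\<phi>' x v) \<le> C * norm v"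
    using derivative_bound by metis
  define s where "s = (\<lambda>k x. real (Suc k) *\<^sub>R (\<phi> (x + inverse (real (Suc k)) *\<^sub>R v) - \<phi> x))"
  have \<phi>: "continuous_on UNIV (\<lambda>x. \<phi> (x + w))" for w
    by (rule continuous_on_compose2[OF continuous]) (auto intro!: continuous_intros)
  have [measurable]: "s k \<in> borel_measurable borel" for k
    unfolding s_def by (intro borel_measurable_continuous_onI continuous_intros \<phi> continuous)
  have [measurable]: "(\<lambda>x. \<phi>' x v) \<in> borel_measurable borel"
    by (intro borel_measurable_continuous_onI continuous_derivative)
  have lipschitz: "norm (\<phi> (x + w) - \<phi> x) \<le> C * norm w" for x w
  proof -
    have "norm (\<phi> (x + w) - \<phi> x) \<le> C * norm (x + w - x)"
      by (rule differentiable_bound[of UNIV \<phi> \<phi>'])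
        (use has_derivative C in \<open>auto intro!: onorm_le\<close>)
    then show ?thesis by simp
  qed
  have "(\<lambda>k. integral\<^sup>L lborel (s k)) \<longlonglongrightarrow> (\<integral>x. \<phi>' x v \<partial>lborel)"
  proof (rule integral_dominated_convergence)
    \<comment> \<open>By the mean value inequality \<open>C * norm v\<close> bounds every difference
      quotient. The radius grows by \<open>norm v\<close> because a shift of at most this length can
      carry a point into the support.\<close>
    show "integrable lborel (\<lambda>x. indicator (cball 0 (R + norm v)) (x::'v) *\<^sub>R (C * norm v))"
      by (intro integrable_scaleR_left integrable_real_indicator emeasure_lborel_cball_finite) auto
    show "AE x in lborel. (\<lambda>k. s k x) \<longlonglongrightarrow> \<phi>' x v"
    proof (intro AE_I2)
      fix x
      have "((\<lambda>t. \<phi> (x + t *\<^sub>R v)) has_derivative (\<lambda>t. \<phi>' (x + 0 *\<^sub>R v) (t *\<^sub>R v))) (at (0::real))"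
        by (rule has_derivative_compose[OF _ has_derivative]) (auto intro!: derivative_eq_intros)
      then have "((\<lambda>t. \<phi> (x + t *\<^sub>R v)) has_vector_derivative \<phi>' x v) (at (0::real))"
        by (simp add: has_vector_derivative_def linear_cmul[OF linear_derivative])
      then have "((\<lambda>t. norm (\<phi> (x + t *\<^sub>R v) - \<phi> x - t *\<^sub>R \<phi>' x v) / norm t) \<longlongrightarrow> 0) (at 0)"
        by (simp add: has_vector_derivative_def has_derivative_at)
      moreover have "norm (\<phi> (x + t *\<^sub>R v) - \<phi> x - t *\<^sub>R \<phi>' x v) / norm t
          = norm ((\<phi> (x + t *\<^sub>R v) - \<phi> x) /\<^sub>R t - \<phi>' x v)" if "t \<noteq> 0" for t
      proof -
        have "(\<phi> (x + t *\<^sub>R v) - \<phi> x) /\<^sub>R t - \<phi>' x v = (\<phi> (x + t *\<^sub>R v) - \<phi> x - t *\<^sub>R \<phi>' x v) /\<^sub>R t"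
          using that by (simp add: scaleR_diff_right)
        then show ?thesis by (simp add: divide_inverse mult.commute)
      qed
      ultimately have "((\<lambda>t. norm ((\<phi> (x + t *\<^sub>R v) - \<phi> x) /\<^sub>R t - \<phi>' x v)) \<longlongrightarrow> 0) (at 0)"
        by (simp cong: LIM_cong)
      then have "((\<lambda>t. (\<phi> (x + t *\<^sub>R v) - \<phi> x) /\<^sub>R t) \<longlongrightarrow> \<phi>' x v) (at 0)"
        by (simp add: tendsto_norm_zero_iff LIM_zero_iff)
      moreover have "filterlim (\<lambda>k. inverse (real (Suc k))) (at 0) sequentially"
        using LIMSEQ_inverse_real_of_nat by (simp add: filterlim_atI)
      ultimately show "(\<lambda>k. s k x) \<longlonglongrightarrow> \<phi>' x v"
        unfolding s_def by (auto dest: filterlim_compose)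
    qed
    show "AE x in lborel. norm (s k x) \<le> indicator (cball 0 (R + norm v)) x *\<^sub>R (C * norm v)" for k
    proof (intro AE_I2)
      fix x
      define w where "w = inverse (real (Suc k)) *\<^sub>R v"
      have w: "norm w \<le> norm v"
        by (simp add: w_def field_simps)
      show "norm (s k x) \<le> indicator (cball 0 (R + norm v)) x *\<^sub>R (C * norm v)"
      proof (cases "norm x \<le> R + norm v")
        case True
        have "norm (s k x) \<le> real (Suc k) * (C * norm w)"
          using lipschitz[of x w] by (simp add: s_def w_def)
        also have "\<dots> = C * norm v"
          by (simp add: w_def field_simps)
        finally show ?thesis using True by simp
      next
        case False
        with w have "norm x > R" "norm (x + w) > R"
          using norm_diff_ineq[of x w] norm_ge_zero[of v] by linarith+
        then show ?thesis
          using False C(1) by (simp add: s_def w_def support)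
      qed
    qed
  qed (auto simp: integrable_derivative)
  moreover have "integral\<^sup>L lborel (s k) = 0" for k
  proof -
    have "integrable lborel \<phi>" by (intro integrable_if_supported continuous support)
    moreover have "integrable lborel (\<lambda>x. \<phi> (x + w))" for w
    proof -
      have "integrable lborel (\<lambda>x. indicator (cball 0 (R + norm w)) x *\<^sub>R \<phi> (x + w))"
        by (rule borel_integrable_compact) (auto intro: continuous_on_subset[OF \<phi>])
      also have "(\<lambda>x. indicator (cball 0 (R + norm w)) x *\<^sub>R \<phi> (x + w)) = (\<lambda>x. \<phi> (x + w))"
      proof
        fix x
        have "\<phi> (x + w) = 0" if "norm x > R + norm w"
          using that norm_diff_ineq[of x w] by (intro support) linarith
        then show "indicator (cball 0 (R + norm w)) x *\<^sub>R \<phi> (x + w) = \<phi> (x + w)"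
          by (auto split: split_indicator simp: not_le)
      qed
      finally show ?thesis .
    qed
    ultimately show ?thesis
      by (simp add: s_def integral_translate)
  qed
  ultimately show ?thesis
    using LIMSEQ_unique[OF tendsto_const] by force
qed

section \<open>The Euler field and the rotation fields against the kernel\<close>

lemma integral_Euler:
  shows "integrable lborel (\<lambda>x. \<phi>' x x /\<^sub>R norm x ^ DIM('v))"
    and "(\<integral>x. \<phi>' x x /\<^sub>R norm x ^ DIM('v) \<partial>lborel)
      = - (real DIM('v) * measure lborel (ball (0::'v) 1)) *\<^sub>R \<phi> 0"
proof -
  obtain C where C: "C \<ge> 0" "\<And>x v. norm (\<phi>' x v) \<le> C * norm v"
    using derivative_bound by metis
  have meas: "(\<lambda>x. \<phi>' x x) \<in> borel_measurable borel"
    by (intro borel_measurable_continuous_onI continuous_derivative_along continuous_intros)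
  note radial = radial_kernel_integral[OF meas C(2) support_derivative]
  show "integrable lborel (\<lambda>x. \<phi>' x x /\<^sub>R norm x ^ DIM('v))"
    by (rule radial)
  \<comment> \<open>The origin is removed because the ray through it is constant and contributes
    \<open>0\<close> instead of -N times \<open>\<phi> 0\<close>; as a null set it does not affect
    the outer integral.\<close>
  have "(\<integral>t. (if 0 < t \<and> norm x < 1 then (real DIM('v) / t) *\<^sub>R \<phi>' (t *\<^sub>R x) (t *\<^sub>R x) else 0) \<partial>lborel)
      = indicator (ball 0 1 - {0}) x *\<^sub>R (- real DIM('v) *\<^sub>R \<phi> 0)" for x
  proof (cases "norm x < 1 \<and> x \<noteq> 0")
    case True
    then have "x \<noteq> 0" by simp
    \<comment> \<open>The ray leaves the ball of radius |R| at the parameter |R| /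
      \<open>norm x\<close>; adding \<open>1\<close> makes the inequality strict, so that
      \<open>\<phi> (T *\<^sub>R x) = 0\<close>.\<close>
    define T where "T = \<bar>R\<bar> / norm x + 1"
    have T: "norm (t *\<^sub>R x) > R" if "t \<ge> T" for t
    proof -
      have "T > 0" using that by (auto simp: T_def intro: add_nonneg_pos)
      have "T * norm x = \<bar>R\<bar> + norm x" using \<open>x \<noteq> 0\<close> by (simp add: T_def field_simps)
      then have "R < T * norm x" using \<open>x \<noteq> 0\<close> zero_less_norm_iff[of x] by linarith
      also have "\<dots> \<le> t * norm x" using that by (intro mult_right_mono) auto
      finally show ?thesis using that \<open>T > 0\<close> by simp
    qed
    have "T \<ge> 0" by (simp add: T_def)
    have "(\<integral>t. (if 0 < t \<and> norm x < 1 then (real DIM('v) / t) *\<^sub>R \<phi>' (t *\<^sub>R x) (t *\<^sub>R x) else 0) \<partial>lborel)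
        = (\<integral>t. indicator {0..T} t *\<^sub>R (real DIM('v) *\<^sub>R \<phi>' (t *\<^sub>R x) x) \<partial>lborel)"
    proof (rule Bochner_Integration.integral_cong_AE)
      show "(\<lambda>t. if 0 < t \<and> norm x < 1 then (real DIM('v) / t) *\<^sub>R \<phi>' (t *\<^sub>R x) (t *\<^sub>R x) else 0)
          \<in> borel_measurable lborel"
      proof -
        have [measurable]: "(\<lambda>t. \<phi>' (t *\<^sub>R x) (t *\<^sub>R x)) \<in> borel_measurable borel"
          by (intro borel_measurable_continuous_onI continuous_derivative_along continuous_intros)
        show ?thesis by measurable
      qed
      show "(\<lambda>t. indicator {0..T} t *\<^sub>R (real DIM('v) *\<^sub>R \<phi>' (t *\<^sub>R x) x)) \<in> borel_measurable lborel"
      proof -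
        have [measurable]: "(\<lambda>t. \<phi>' (t *\<^sub>R x) x) \<in> borel_measurable borel"
          by (intro borel_measurable_continuous_onI continuous_derivative_along continuous_intros)
        show ?thesis by measurable
      qed
      show "AE t in lborel. (if 0 < t \<and> norm x < 1 then (real DIM('v) / t) *\<^sub>R \<phi>' (t *\<^sub>R x) (t *\<^sub>R x) else 0)
          = indicator {0..T} t *\<^sub>R (real DIM('v) *\<^sub>R \<phi>' (t *\<^sub>R x) x)"
        using AE_lborel_singleton[of 0]
      proof eventually_elim
        case (elim t)
        show ?case
          using elim True T[of t] support_derivative[of "t *\<^sub>R x"]
          by (auto simp: linear_cmul[OF linear_derivative] split: split_indicator)
      qed
    qed
    \<comment> \<open>The factor 1/t has been cancelled by linearity in the direction
      \<open>t *\<^sub>R x\<close>. What remains is the derivative of \<open>\<phi>\<close> along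
      the ray, and the far end contributes nothing.\<close>
    also have "\<dots> = real DIM('v) *\<^sub>R \<phi> (T *\<^sub>R x) - real DIM('v) *\<^sub>R \<phi> (0 *\<^sub>R x)"
    proof (rule integral_FTC_Icc[OF \<open>T \<ge> 0\<close>])
      show "continuous_on {0..T} (\<lambda>t. real DIM('v) *\<^sub>R \<phi>' (t *\<^sub>R x) x)"
        by (intro continuous_derivative_along continuous_intros)
      show "((\<lambda>t. real DIM('v) *\<^sub>R \<phi> (t *\<^sub>R x)) has_vector_derivative real DIM('v) *\<^sub>R \<phi>' (t *\<^sub>R x) x)
          (at t within {0..T})" for t
      proof -
        have "((\<lambda>t. \<phi> (t *\<^sub>R x)) has_derivative (\<lambda>h. \<phi>' (t *\<^sub>R x) (h *\<^sub>R x))) (at t within {0..T})"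
          by (rule has_derivative_compose[OF _ has_derivative]) (auto intro!: derivative_eq_intros)
        then have "((\<lambda>t. \<phi> (t *\<^sub>R x)) has_vector_derivative \<phi>' (t *\<^sub>R x) x) (at t within {0..T})"
          by (simp add: has_vector_derivative_def linear_cmul[OF linear_derivative])
        then show ?thesis
          by (rule bounded_linear.has_vector_derivative[OF bounded_linear_scaleR_right])
      qed
    qed
    finally show ?thesis
      using True T[of T] support[of "T *\<^sub>R x"] by simp
  next
    case False
    then have "(if 0 < t \<and> norm x < 1 then (real DIM('v) / t) *\<^sub>R \<phi>' (t *\<^sub>R x) (t *\<^sub>R x) else 0) = 0" for t
      using linear_0[OF linear_derivative] by auto
    then show ?thesis using False by (auto split: split_indicator)
  qed
  then have "(\<integral>x. \<integral>t. (if 0 < t \<and> norm x < 1 then (real DIM('v) / t) *\<^sub>R \<phi>' (t *\<^sub>R x) (t *\<^sub>R x) else 0)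
        \<partial>lborel \<partial>lborel)
      = (\<integral>x. indicator (ball 0 1 - {0}) (x::'v) *\<^sub>R (- real DIM('v) *\<^sub>R \<phi> 0) \<partial>lborel)"
    by simp
  also have "\<dots> = - (real DIM('v) * measure lborel (ball (0::'v) 1)) *\<^sub>R \<phi> 0"
  proof -
    have "has_bochner_integral lborel (\<lambda>x. indicator (ball 0 1 - {0}) (x::'v) *\<^sub>R (- real DIM('v) *\<^sub>R \<phi> 0))
       (measure lborel (ball (0::'v) 1 - {0}) *\<^sub>R (- real DIM('v) *\<^sub>R \<phi> 0))"
      by (rule has_bochner_integral_indicator)
        (use emeasure_bounded_finite[OF bounded_diff[OF bounded_ball]] in auto)
    moreover have "measure lborel (ball (0::'v) 1 - {0}) = measure lborel (ball (0::'v) 1)"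
      by (rule measure_Diff_null_set) auto
    ultimately show ?thesis
      by (auto dest!: has_bochner_integral_integral_eq simp: mult.commute)
  qed
  finally show "(\<integral>x. \<phi>' x x /\<^sub>R norm x ^ DIM('v) \<partial>lborel)
      = - (real DIM('v) * measure lborel (ball (0::'v) 1)) *\<^sub>R \<phi> 0"
    using radial(2) by simp
qed

text \<open>Apply \<open>integral_derivative\<close> to the products of \<open>\<phi>\<close> with
  \<open>h x * (x \<bullet> u)\<close> and \<open>h x * (x \<bullet> v)\<close>, in the directions
  \<open>v\<close> and \<open>u\<close> respectively. The gradient of the radial weight
  \<open>h\<close> is a multiple of \<open>x\<close>, so the terms in which \<open>\<phi>\<close> is
  not differentiated are symmetric in \<open>u\<close> and \<open>v\<close> and cancel in the
  difference. With \<open>\<epsilon> > 0\<close> the weight is differentiable at the origin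
  too.\<close>

lemma integral_rotation_regularized:
  fixes \<epsilon> \<alpha> :: real
  assumes "\<epsilon> > 0"
  shows "(\<integral>x. ((x \<bullet> x + \<epsilon>) powr \<alpha>) *\<^sub>R ((x \<bullet> u) *\<^sub>R \<phi>' x v - (x \<bullet> v) *\<^sub>R \<phi>' x u) \<partial>lborel) = 0"
proof -
  define h where "h = (\<lambda>x::'v. (x \<bullet> x + \<epsilon>) powr \<alpha>)"
  define h' where "h' = (\<lambda>x w::'v. \<alpha> * (x \<bullet> x + \<epsilon>) powr (\<alpha> - 1) * (2 * (x \<bullet> w)))"
  define G' where "G' = (\<lambda>u x w. (h x * (x \<bullet> u)) *\<^sub>R \<phi>' x w + (h x * (w \<bullet> u) + h' x w * (x \<bullet> u)) *\<^sub>R \<phi> x)"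
  have pos: "x \<bullet> x + \<epsilon> > 0" for x :: 'v
    using assms by (simp add: add_nonneg_pos)
  have h: "(h has_derivative h' x) (at x)" for x
  proof -
    have "((\<lambda>x::'v. x \<bullet> x + \<epsilon>) has_derivative (\<lambda>w. 2 * (x \<bullet> w))) (at x)"
      by (auto intro!: derivative_eq_intros simp: inner_commute)
    moreover have "((\<lambda>y. y powr \<alpha>) has_derivative (*) (\<alpha> * (x \<bullet> x + \<epsilon>) powr (\<alpha> - 1))) (at (x \<bullet> x + \<epsilon>))"
      using has_real_derivative_powr[OF pos[of x], of \<alpha>] by (rule has_field_derivative_imp_has_derivative)
    ultimately show ?thesis
      unfolding h_def h'_def by (rule has_derivative_compose)
  qed
  have cont_h: "continuous_on UNIV h" "continuous_on UNIV (\<lambda>x. h' x w)" for w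
    unfolding h_def h'_def by (intro continuous_intros ballI less_imp_neq[OF pos, symmetric])+
  have G: "compactly_supported_C1 (\<lambda>x. (h x * (x \<bullet> u)) *\<^sub>R \<phi> x) (G' u) R" for u
  proof
    show "((\<lambda>x. (h x * (x \<bullet> u)) *\<^sub>R \<phi> x) has_derivative G' u x) (at x)" for x
    proof -
      have "((\<lambda>x. h x * (x \<bullet> u)) has_derivative (\<lambda>w. h x * (w \<bullet> u) + h' x w * (x \<bullet> u))) (at x)"
        by (intro has_derivative_mult h has_derivative_inner_left has_derivative_ident)
      from has_derivative_scaleR[OF this has_derivative] show ?thesis
        unfolding G'_def .
    qed
    show "continuous_on UNIV (\<lambda>x. G' u x v)" for v
      unfolding G'_def by (intro continuous_intros cont_h continuous_derivative continuous)
  qed (simp add: support)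
  have "0 = (\<integral>x. G' u x v \<partial>lborel) - (\<integral>x. G' v x u \<partial>lborel)"
    by (simp add: compactly_supported_C1.integral_derivative[OF G])
  also have "\<dots> = (\<integral>x. G' u x v - G' v x u \<partial>lborel)"
    by (simp add: compactly_supported_C1.integrable_derivative[OF G])
  also have "(\<lambda>x. G' u x v - G' v x u) = (\<lambda>x. h x *\<^sub>R ((x \<bullet> u) *\<^sub>R \<phi>' x v - (x \<bullet> v) *\<^sub>R \<phi>' x u))"
  proof
    fix x
    have swap: "h x * (v \<bullet> u) + h' x v * (x \<bullet> u) = h x * (u \<bullet> v) + h' x u * (x \<bullet> v)"
      by (simp add: h'_def inner_commute[of v u])
    show "G' u x v - G' v x u = h x *\<^sub>R ((x \<bullet> u) *\<^sub>R \<phi>' x v - (x \<bullet> v) *\<^sub>R \<phi>' x u)"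
      unfolding G'_def swap by (simp add: scaleR_diff_right)
  qed
  finally show ?thesis by (simp add: h_def)
qed

lemma
  shows integrable_rotation:
      "integrable lborel (\<lambda>x. ((x \<bullet> u) *\<^sub>R \<phi>' x v - (x \<bullet> v) *\<^sub>R \<phi>' x u) /\<^sub>R norm x ^ DIM('v))"
    and integral_rotation:
      "(\<integral>x. ((x \<bullet> u) *\<^sub>R \<phi>' x v - (x \<bullet> v) *\<^sub>R \<phi>' x u) /\<^sub>R norm x ^ DIM('v) \<partial>lborel) = 0"
proof -
  define W where "W = (\<lambda>x. (x \<bullet> u) *\<^sub>R \<phi>' x v - (x \<bullet> v) *\<^sub>R \<phi>' x u)"
  define \<alpha> where "\<alpha> = - real DIM('v) / 2"
  define s where "s = (\<lambda>k x. ((x \<bullet> x + inverse (real (Suc k))) powr \<alpha>) *\<^sub>R W x)"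
  obtain C where C: "C \<ge> 0" "\<And>x v. norm (\<phi>' x v) \<le> C * norm v"
    using derivative_bound by metis
  have [measurable]: "W \<in> borel_measurable borel"
    unfolding W_def by (intro borel_measurable_continuous_onI continuous_intros continuous_derivative)
  have W: "norm (W x) \<le> (2 * C * norm u * norm v) * norm x" for x
  proof -
    have "norm (W x) \<le> \<bar>x \<bullet> u\<bar> * norm (\<phi>' x v) + \<bar>x \<bullet> v\<bar> * norm (\<phi>' x u)"
      unfolding W_def by (metis norm_triangle_ineq4 norm_scaleR)
    also have "\<dots> \<le> (norm x * norm u) * (C * norm v) + (norm x * norm v) * (C * norm u)"
      by (intro add_mono mult_mono C Cauchy_Schwarz_ineq2) auto
    finally show ?thesis by (simp add: algebra_simps)
  qed
  have int: "integrable lborel (\<lambda>x. W x /\<^sub>R norm x ^ DIM('v))"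
  proof (rule radial_kernel_integral(1)[OF _ W])
    show "W x = 0" if "norm x > R" for x
      using that by (simp add: W_def support_derivative)
  qed simp
  then show "integrable lborel (\<lambda>x. ((x \<bullet> u) *\<^sub>R \<phi>' x v - (x \<bullet> v) *\<^sub>R \<phi>' x u) /\<^sub>R norm x ^ DIM('v))"
    by (simp add: W_def)
  have \<alpha>: "(x \<bullet> x) powr \<alpha> = inverse (norm x ^ DIM('v))" if "x \<noteq> 0" for x :: 'v
  proof -
    have "(x \<bullet> x) powr \<alpha> = (norm x powr 2) powr \<alpha>"
      using that by (simp add: dot_square_norm)
    also have "\<dots> = inverse (norm x powr DIM('v))"
      unfolding powr_powr by (simp add: \<alpha>_def powr_minus)
    finally show ?thesis using that by (simp add: powr_realpow)
  qed
  have "(\<lambda>k. integral\<^sup>L lborel (s k)) \<longlonglongrightarrow> (\<integral>x. W x /\<^sub>R norm x ^ DIM('v) \<partial>lborel)"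
  proof (rule integral_dominated_convergence)
    \<comment> \<open>The exponent \<open>\<alpha>\<close> is negative, so the regularized weights
      stay below their limit, and the norm of the limit itself dominates the sequence.\<close>
    show "integrable lborel (\<lambda>x. norm (W x /\<^sub>R norm x ^ DIM('v)))"
      using int by (rule integrable_norm)
    show "AE x in lborel. (\<lambda>k. s k x) \<longlonglongrightarrow> W x /\<^sub>R norm x ^ DIM('v)"
      using AE_lborel_singleton[of "0::'v"]
    proof eventually_elim
      case (elim x)
      have "(\<lambda>k. s k x) \<longlonglongrightarrow> ((x \<bullet> x + 0) powr \<alpha>) *\<^sub>R W x"
        unfolding s_def using elim
        by (intro tendsto_intros LIMSEQ_inverse_real_of_nat) auto
      then show ?case using \<alpha>[OF elim] by simp
    qed
    show "AE x in lborel. norm (s k x) \<le> norm (W x /\<^sub>R norm x ^ DIM('v))" for k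
      using AE_lborel_singleton[of "0::'v"]
    proof eventually_elim
      case (elim x)
      have "(x \<bullet> x + inverse (real (Suc k))) powr \<alpha> \<le> (x \<bullet> x) powr \<alpha>"
        using elim by (intro powr_mono2') (auto simp: \<alpha>_def)
      then show ?case
        using \<alpha>[OF elim] by (simp add: s_def mult_right_mono)
    qed
  qed (auto simp: s_def)
  moreover have "integral\<^sup>L lborel (s k) = 0" for k
    unfolding s_def W_def by (rule integral_rotation_regularized) simp
  ultimately have "(\<lambda>_. 0) \<longlonglongrightarrow> (\<integral>x. W x /\<^sub>R norm x ^ DIM('v) \<partial>lborel)"
    by simp
  then show "(\<integral>x. ((x \<bullet> u) *\<^sub>R \<phi>' x v - (x \<bullet> v) *\<^sub>R \<phi>' x u) /\<^sub>R norm x ^ DIM('v) \<partial>lborel) = 0"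
    unfolding W_def by (rule LIMSEQ_unique[OF _ tendsto_const])
qed

end

text \<open>\<open>Ck\<close> speaks of basis directions; linearity of the derivative extends
  continuity to every direction. \<open>R\<close> bounds the compact support.\<close>

lemma test_function_compactly_supported_C1:
  assumes "test_function \<phi>"
  obtains R where "compactly_supported_C1 \<phi> (\<lambda>x. frechet_derivative \<phi> (at x)) R"
proof -
  have "Ck (Suc 0) \<phi>" and compact: "compact (closure {x. \<phi> x \<noteq> 0})"
    using assms by (simp_all add: test_function_def del: Ck.simps)
  then have diff: "\<phi> differentiable (at x)"
    and cont: "v \<in> Basis \<Longrightarrow> continuous_on UNIV (\<lambda>x. frechet_derivative \<phi> (at x) v)" for x v
    by auto
  have deriv: "(\<phi> has_derivative frechet_derivative \<phi> (at x)) (at x)" for x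
    using diff frechet_derivative_works by blast
  obtain R where R: "\<And>x. x \<in> closure {x. \<phi> x \<noteq> 0} \<Longrightarrow> norm x \<le> R"
    using compact_imp_bounded[OF compact] by (auto simp: bounded_iff)
  show thesis
  proof (rule that[of R], unfold_locales)
    show "(\<phi> has_derivative frechet_derivative \<phi> (at x)) (at x)" for x
      by (rule deriv)
    show "continuous_on UNIV (\<lambda>x. frechet_derivative \<phi> (at x) v)" for v
    proof -
      have expand: "frechet_derivative \<phi> (at x) v = (\<Sum>u\<in>Basis. (v \<bullet> u) *\<^sub>R frechet_derivative \<phi> (at x) u)" for x
        using deriv by (intro linear_euclidean_expand has_derivative_linear)
      show ?thesis
        unfolding expand by (intro continuous_intros cont)
    qed
    show "\<phi> x = 0" if "norm x > R" for x
    proof (rule ccontr)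
      assume "\<phi> x \<noteq> 0"
      then have "x \<in> closure {x. \<phi> x \<noteq> 0}"
        by (intro subsetD[OF closure_subset]) simp
      with R[of x] that show False by simp
    qed
  qed
qed

section \<open>Coefficients of wedge products\<close>

lemma sum_fun_apply: "(\<Sum>i\<in>A. f i) x = (\<Sum>i\<in>A. f i x)"
  by (induction A rule: infinite_finite_induct) auto

text \<open>An infinite set has infinitely many subsets, and a sum over an infinite set is
  \<open>0\<close> by convention. Equalities of forms range over all index sets, so this case does
  occur.\<close>

lemma wedge_infinite: "infinite I \<Longrightarrow> (\<alpha> \<and>\<^sub>f \<beta>) I = 0"
  by (simp add: wedge_def finite_Pow_iff)

lemma wedge_sum_left: "(\<Sum>i\<in>A. f i) \<and>\<^sub>f \<beta> = (\<Sum>i\<in>A. f i \<and>\<^sub>f \<beta>)"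
  unfolding wedge_def
  by (rule ext) (simp add: sum_fun_apply sum_distrib_left sum_distrib_right sum.swap[of _ A])

lemma wedge_sum_right: "\<alpha> \<and>\<^sub>f (\<Sum>i\<in>A. f i) = (\<Sum>i\<in>A. \<alpha> \<and>\<^sub>f f i)"
  unfolding wedge_def
  by (rule ext) (simp add: sum_fun_apply sum_distrib_left sum.swap[of _ A])

lemma neg_one_power_mult_left_commute:
  "(- 1) ^ k * (u * v) = u * ((- 1) ^ k * (v :: 'a::ring_1))"
  by (cases "even k") auto

lemma fscale_wedge: "fscale u \<alpha> \<and>\<^sub>f \<beta> = fscale u (\<alpha> \<and>\<^sub>f \<beta>)"
  unfolding wedge_def fscale_def
  by (rule ext) (simp add: sum_distrib_left mult.assoc neg_one_power_mult_left_commute[of _ u])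

lemma fscale_apply: "fscale u \<omega> I = u * \<omega> I"
  by (simp add: fscale_def)

lemma linear_mult_left:
  fixes f :: "'v::real_vector \<Rightarrow> 'a::real_algebra"
  shows "linear f \<Longrightarrow> linear (\<lambda>x. c * f x)"
  by (rule linearI) (simp_all add: linear_add linear_scale distrib_left)

text \<open>Serves \<open>kernel_linear\<close>: the numerator of the kernel is linear in the point,
  hence bounded by a multiple of \<open>norm x\<close>.\<close>

lemma linear_wedge_right:
  assumes "\<And>J. linear (\<lambda>x. \<beta> x J)"
  shows "linear (\<lambda>x. (\<alpha> \<and>\<^sub>f \<beta> x) I)"
  unfolding wedge_def by (intro linear_compose_sum ballI linear_mult_left assms)

text \<open>Only the subset \<open>{\<kappa>}\<close> contributes, and its sign counts the smaller
  indices that \<open>dx \<kappa>\<close> has to pass.\<close>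

lemma dx_wedge_apply:
  assumes "finite I"
  shows "(dx \<kappa> \<and>\<^sub>f \<beta>) I = (if \<kappa> \<in> I then (- 1) ^ card {\<nu>\<in>I. \<nu> < \<kappa>} * \<beta> (I - {\<kappa>}) else 0)"
proof -
  define sgn where "sgn = (\<lambda>J. (- 1 :: 'a) ^ card {(\<mu>, \<nu>). \<mu> \<in> J \<and> \<nu> \<in> I - J \<and> \<nu> < \<mu>})"
  have "(dx \<kappa> \<and>\<^sub>f \<beta>) I = (\<Sum>J\<in>Pow I. if {\<kappa>} = J then sgn J * \<beta> (I - J) else 0)"
    unfolding wedge_def sgn_def by (intro sum.cong) (auto simp: dx_def)
  also have "\<dots> = (if \<kappa> \<in> I then sgn {\<kappa>} * \<beta> (I - {\<kappa>}) else 0)"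
    using assms by (simp add: sum.delta)
  also have "{(\<mu>, \<nu>). \<mu> \<in> {\<kappa>} \<and> \<nu> \<in> I - {\<kappa>} \<and> \<nu> < \<mu>} = Pair \<kappa> ` {\<nu>\<in>I. \<nu> < \<kappa>}"
    by auto
  then have "sgn {\<kappa>} = (- 1) ^ card {\<nu>\<in>I. \<nu> < \<kappa>}"
    by (simp add: sgn_def card_image inj_on_def)
  finally show ?thesis by simp
qed

text \<open>Here \<open>dx \<kappa>\<close> stands last, so only the complement of
  \<open>\<kappa>\<close> in \<open>I\<close> contributes, and the indices to be passed are the
  larger ones.\<close>

lemma wedge_dx_apply:
  assumes "finite I"
  shows "(\<alpha> \<and>\<^sub>f fscale u (dx \<kappa>)) I
    = (if \<kappa> \<in> I then (- 1) ^ card {\<nu>\<in>I. \<kappa> < \<nu>} * (\<alpha> (I - {\<kappa>}) * u) else 0)"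
proof -
  define sgn where "sgn = (\<lambda>J. (- 1 :: 'a) ^ card {(\<mu>, \<nu>). \<mu> \<in> J \<and> \<nu> \<in> I - J \<and> \<nu> < \<mu>})"
  have "(\<alpha> \<and>\<^sub>f fscale u (dx \<kappa>)) I
      = (\<Sum>J\<in>Pow I. if J = I - {\<kappa>} then (if \<kappa> \<in> I then sgn J * (\<alpha> J * u) else 0) else 0)"
    unfolding wedge_def sgn_def
  proof (intro sum.cong refl)
    fix J assume "J \<in> Pow I"
    then have "I - J = {\<kappa>} \<longleftrightarrow> J = I - {\<kappa>} \<and> \<kappa> \<in> I"
      by auto
    then show "(- 1) ^ card {(\<mu>, \<nu>). \<mu> \<in> J \<and> \<nu> \<in> I - J \<and> \<nu> < \<mu>} * (\<alpha> J * fscale u (dx \<kappa>) (I - J))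
        = (if J = I - {\<kappa>} then if \<kappa> \<in> I
           then (- 1) ^ card {(\<mu>, \<nu>). \<mu> \<in> J \<and> \<nu> \<in> I - J \<and> \<nu> < \<mu>} * (\<alpha> J * u) else 0 else 0)"
      by (simp add: fscale_def dx_def)
  qed
  also have "\<dots> = (if \<kappa> \<in> I then sgn (I - {\<kappa>}) * (\<alpha> (I - {\<kappa>}) * u) else 0)"
    using assms by (simp add: sum.delta')
  also have "sgn (I - {\<kappa>}) = (- 1) ^ card {\<nu>\<in>I. \<kappa> < \<nu>}" if "\<kappa> \<in> I"
  proof -
    have "{(\<mu>, \<nu>). \<mu> \<in> I - {\<kappa>} \<and> \<nu> \<in> I - (I - {\<kappa>}) \<and> \<nu> < \<mu>} = (\<lambda>\<mu>. (\<mu>, \<kappa>)) ` {\<nu>\<in>I. \<kappa> < \<nu>}"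
      using that by auto
    then show ?thesis
      by (simp add: sgn_def card_image inj_on_def)
  qed
  then have "(if \<kappa> \<in> I then sgn (I - {\<kappa>}) * (\<alpha> (I - {\<kappa>}) * u) else 0)
    = (if \<kappa> \<in> I then (- 1) ^ card {\<nu>\<in>I. \<kappa> < \<nu>} * (\<alpha> (I - {\<kappa>}) * u) else 0)"
    by simp
  finally show ?thesis .
qed

lemma dx_wedge_const_form:
  fixes u :: "'a::real_algebra_1"
  shows "dx \<mu> \<and>\<^sub>f const_form u = fscale u (dx \<mu>)"
proof
  fix I
  show "(dx \<mu> \<and>\<^sub>f const_form u) I = fscale u (dx \<mu>) I"
  proof (cases "finite I")
    case True
    have iff: "\<mu> \<in> I \<and> I - {\<mu>} = {} \<longleftrightarrow> I = {\<mu>}" by auto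
    have "{\<nu>\<in>{\<mu>}. \<nu> < \<mu>} = {}" by auto
    then have "(- 1) ^ card {\<nu>\<in>I. \<nu> < \<mu>} = (1::'a)" if "I = {\<mu>}"
      unfolding that by (simp only: card.empty power_0)
    then show ?thesis
      unfolding dx_wedge_apply[OF True] using iff
      by (cases "I = {\<mu>}") (auto simp: const_form_def fscale_def dx_def)
  next
    case False
    then have "I \<noteq> {\<mu>}" by auto
    with False show ?thesis by (simp add: wedge_infinite fscale_def dx_def)
  qed
qed

text \<open>The head of a strictly increasing list is smaller than all other indices, so no step
  produces a sign.\<close>

lemma foldr_dx_wedge:
  assumes "sorted_wrt (<) xs"
  shows "foldr (\<lambda>\<kappa> \<omega>. dx \<kappa> \<and>\<^sub>f \<omega>) xs (const_form 1) = (\<lambda>I. if I = set xs then 1 else 0 :: 'a::real_algebra_1)"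
  using assms
proof (induction xs)
  case (Cons x xs)
  then have IH: "foldr (\<lambda>\<kappa> \<omega>. dx \<kappa> \<and>\<^sub>f \<omega>) xs (const_form 1) = (\<lambda>I. if I = set xs then 1 else 0 :: 'a)"
    by simp
  show ?case
  proof
    fix I
    have step: "foldr (\<lambda>\<kappa> \<omega>. dx \<kappa> \<and>\<^sub>f \<omega>) (x # xs) (const_form 1) I
        = (dx x \<and>\<^sub>f (\<lambda>I. if I = set xs then 1 else 0 :: 'a)) I"
      by (simp only: foldr_Cons o_apply IH)
    show "foldr (\<lambda>\<kappa> \<omega>. dx \<kappa> \<and>\<^sub>f \<omega>) (x # xs) (const_form 1) I = (if I = set (x # xs) then 1 else 0 :: 'a)"
    proof (cases "finite I")
      case True
      have "x \<notin> set xs" using Cons.prems by auto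
      then have iff: "x \<in> I \<and> I - {x} = set xs \<longleftrightarrow> I = insert x (set xs)" by auto
      have no_less: "{\<nu>\<in>insert x (set xs). \<nu> < x} = {}"
        using Cons.prems by auto
      show ?thesis
      proof (cases "I = insert x (set xs)")
        case True
        have "insert x (set xs) - {x} = set xs"
          using \<open>x \<notin> set xs\<close> by auto
        with True no_less show ?thesis
          unfolding step by (simp add: dx_wedge_apply del: Collect_empty_eq)
      next
        case False
        then show ?thesis
          using \<open>finite I\<close> iff unfolding step by (auto simp: dx_wedge_apply)
      qed
    next
      case False
      then show ?thesis unfolding step by (auto simp: wedge_infinite)
    qed
  qed
qed (simp add: const_form_def)

lemma dx_omit_eq: "dx_omit N \<mu> \<nu> = (\<lambda>I. if I = {..<N} - {\<mu>, \<nu>} then 1 else 0)"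
proof -
  have "set (filter (\<lambda>\<kappa>. \<kappa> \<noteq> \<mu> \<and> \<kappa> \<noteq> \<nu>) [0..<N]) = {..<N} - {\<mu>, \<nu>}"
    by auto
  then show ?thesis
    unfolding dx_omit_def by (subst foldr_dx_wedge) (simp_all add: sorted_wrt_filter)
qed

section \<open>Blocks of coordinates\<close>

text \<open>\<open>bij_position\<close> says that the blocks are runs of consecutive positions that
  partition all coordinates. Injectivity separates the monomials of different blocks; bijectivity
  turns a sum over blocks into a sum over the standard basis, as the Euler field requires.\<close>

locale coordinate_blocks =
  fixes N :: nat and \<B> :: "'i set" and lead len :: "'i \<Rightarrow> nat"
    and U :: "'i \<Rightarrow> nat \<Rightarrow> 'a::{real_algebra_1, euclidean_space}"
    and b :: "nat \<Rightarrow> 'v::euclidean_space"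
  assumes finite_blocks: "finite \<B>"
    and bij_position: "bij_betw (\<lambda>(B, j). lead B + j) (SIGMA B:\<B>. {..len B}) {..<N}"
    and bij_coordinate: "bij_betw b {..<N} Basis"
    and U_lead: "\<And>B. B \<in> \<B> \<Longrightarrow> U B 0 = 1"
    and sum_U_squares: "\<And>B. B \<in> \<B> \<Longrightarrow> (\<Sum>j\<le>len B. (U B j)\<^sup>2) = 0"
begin

text \<open>The weights \<open>w\<close> stay free so that signs can be computed apart from the
  kernel. The exponent \<open>j\<close> is the distance to the leading position: together with the
  \<open>lead B\<close> smaller indices that \<open>dx (lead B)\<close> has to pass, it yields the
  sign of the absolute position \<open>lead B + j\<close>.\<close>

definition block_form :: "('i \<Rightarrow> nat \<Rightarrow> 'a) \<Rightarrow> 'a form" where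
  "block_form w = (\<Sum>B\<in>\<B>. (\<Sum>j\<le>len B. fscale (U B j) (dx (lead B + j)))
     \<and>\<^sub>f (\<Sum>j=1..len B. fscale ((- 1) ^ j * w B j) (dx_omit N (lead B) (lead B + j))))"

lemma N_eq: "N = DIM('v)"
  using bij_betw_same_card[OF bij_coordinate] by simp

lemma position_less: "B \<in> \<B> \<Longrightarrow> j \<le> len B \<Longrightarrow> lead B + j < N"
  using bij_betwE[OF bij_position] by auto

lemma position_eq_iff:
  assumes "B \<in> \<B>" "j \<le> len B" "B' \<in> \<B>" "j' \<le> len B'"
  shows "lead B + j = lead B' + j' \<longleftrightarrow> B = B' \<and> j = j'"
  using bij_betw_imp_inj_on[OF bij_position] assms by (auto simp: inj_on_def)

text \<open>Only \<open>dx\<close> of the leading coordinate of the block completes an omitted pair to a form that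
  misses just a non-leading coordinate.\<close>
lemma block_form_apply:
  assumes B: "B \<in> \<B>" and j: "1 \<le> j" "j \<le> len B"
  shows "block_form w ({..<N} - {lead B + j}) = (- 1) ^ (lead B + j) * w B j"
proof -
  define I where "I = {..<N} - {lead B + j}"
  have [simp]: "finite I" by (simp add: I_def)
  define v where "v = (- 1) ^ (lead B + j) * w B j"
  have cell: "(fscale (U B' k) (dx (lead B' + k)) \<and>\<^sub>f
        fscale ((- 1) ^ l * w B' l) (dx_omit N (lead B') (lead B' + l))) I
      = (if B' = B then if k = 0 then if l = j then v else 0 else 0 else 0)"
    if B': "B' \<in> \<B>" and k: "k \<le> len B'" and l: "1 \<le> l" "l \<le> len B'" for B' k l
  proof (cases "B' = B \<and> k = 0 \<and> l = j")
    case True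
    have "{\<nu>\<in>I. \<nu> < lead B} = {..<lead B}"
      using position_less[OF B j(2)] by (auto simp: I_def)
    moreover have "lead B \<in> I"
      using position_less[OF B, of 0] j by (simp add: I_def)
    moreover have "I - {lead B} = {..<N} - {lead B, lead B + j}"
      by (auto simp: I_def)
    ultimately show ?thesis
      using True
      by (simp add: fscale_wedge fscale_apply dx_wedge_apply dx_omit_eq U_lead[OF B]
          v_def power_add mult.assoc)
  next
    case False
    \<comment> \<open>Equality would make the two-element complements agree. As
      \<open>j \<ge> 1\<close>, the position \<open>lead B + j\<close> does not lead a block, so it
      must be \<open>lead B' + l\<close>; this leaves \<open>lead B' + k\<close> as the leading
      position, which is the excluded case.\<close>
    have "I - {lead B' + k} \<noteq> {..<N} - {lead B', lead B' + l}" if "lead B' + k \<in> I"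
    proof
      assume eq: "I - {lead B' + k} = {..<N} - {lead B', lead B' + l}"
      have "{lead B + j, lead B' + k} = {..<N} - (I - {lead B' + k})"
        using position_less[OF B j(2)] position_less[OF B' k] by (auto simp: I_def)
      also have "\<dots> = {lead B' + 0, lead B' + l}"
        unfolding eq using position_less[OF B', of 0] position_less[OF B' l(2)] by auto
      finally have set: "{lead B + j, lead B' + k} = {lead B' + 0, lead B' + l}" .
      then have "lead B + j = lead B' + 0 \<or> lead B + j = lead B' + l"
        by (auto simp: doubleton_eq_iff)
      then have Bj: "B' = B" "l = j"
        using position_eq_iff[OF B j(2) B' le0] position_eq_iff[OF B j(2) B' l(2)] j by auto
      with set l have "k = 0"
        by (auto simp: doubleton_eq_iff)
      with Bj False show False by simp
    qed
    then have "(fscale (U B' k) (dx (lead B' + k)) \<and>\<^sub>f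
        fscale ((- 1) ^ l * w B' l) (dx_omit N (lead B') (lead B' + l))) I = 0"
      unfolding fscale_wedge fscale_apply dx_wedge_apply[OF \<open>finite I\<close>] dx_omit_eq
      by (cases "lead B' + k \<in> I") simp_all
    moreover have "(if B' = B then if k = 0 then if l = j then v else 0 else 0 else 0) = 0"
      using False by auto
    ultimately show ?thesis by simp
  qed
  have "block_form w I = (\<Sum>B'\<in>\<B>. \<Sum>k\<le>len B'. \<Sum>l=1..len B'.
      if B' = B then if k = 0 then if l = j then v else 0 else 0 else 0)"
    unfolding block_form_def wedge_sum_left unfolding wedge_sum_right sum_fun_apply
    by (intro sum.cong refl cell) auto
  also have "\<dots> = (\<Sum>B'\<in>\<B>. if B' = B then v else 0)"
  proof (rule sum.cong)
    fix B' assume "B' \<in> \<B>"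
    show "(\<Sum>k\<le>len B'. \<Sum>l=1..len B'. if B' = B then if k = 0 then if l = j then v else 0 else 0 else 0)
      = (if B' = B then v else 0)"
    proof (cases "B' = B")
      case True
      have "(\<Sum>l=1..len B. if k = 0 then if l = j then v else 0 else 0) = (if k = 0 then v else 0)" for k :: nat
        using j by (simp add: sum.delta')
      with True show ?thesis by simp
    qed simp
  qed simp
  also have "\<dots> = v"
    using B finite_blocks by simp
  finally show ?thesis by (simp add: I_def v_def)
qed

text \<open>Appending \<open>dx (lead B + j)\<close> costs a sign with exponent
  \<open>N - 1 - (lead B + j)\<close>, while the coefficient of \<open>block_form\<close> carries
  one with exponent \<open>lead B + j\<close>. The product does not depend on the block, so the
  contributions of all blocks add up without relative signs.\<close>

lemma block_form_wedge_top:
  "(fscale c (block_form w) \<and>\<^sub>f (\<Sum>B\<in>\<B>. \<Sum>j=1..len B. fscale (g B j) (dx (lead B + j)))) {..<N}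
   = (- 1) ^ (N - 1) * (c * (\<Sum>B\<in>\<B>. \<Sum>j=1..len B. w B j * g B j))"
proof -
  have "(fscale c (block_form w) \<and>\<^sub>f fscale (g B j) (dx (lead B + j))) {..<N}
      = (- 1) ^ (N - 1) * (c * (w B j * g B j))" if "B \<in> \<B>" "j \<in> {1..len B}" for B j
  proof -
    let ?\<mu> = "lead B + j"
    have less: "?\<mu> < N" using that position_less by auto
    have "{\<nu>\<in>{..<N}. ?\<mu> < \<nu>} = {?\<mu><..<N}" by auto
    then have card: "card {\<nu>\<in>{..<N}. ?\<mu> < \<nu>} = N - 1 - ?\<mu>"
      by (simp only:) simp
    have sign: "(- 1) ^ (N - 1 - ?\<mu>) * ((- 1) ^ ?\<mu> * u) = (- 1) ^ (N - 1) * (u :: 'a)" for u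
      using less by (simp add: mult.assoc[symmetric] flip: power_add)
    have "(fscale c (block_form w) \<and>\<^sub>f fscale (g B j) (dx ?\<mu>)) {..<N}
      = (- 1) ^ (N - 1 - ?\<mu>) * (c * ((- 1) ^ ?\<mu> * w B j) * g B j)"
      using that less by (simp add: fscale_wedge wedge_dx_apply card[simplified] fscale_apply block_form_apply
          mult.assoc neg_one_power_mult_left_commute[of _ c])
    also have "\<dots> = (- 1) ^ (N - 1 - ?\<mu>) * ((- 1) ^ ?\<mu> * (c * (w B j * g B j)))"
      by (simp add: mult.assoc neg_one_power_mult_left_commute[of _ c])
    also have "\<dots> = (- 1) ^ (N - 1) * (c * (w B j * g B j))"
      by (rule sign)
    finally show ?thesis .
  qed
  then show ?thesis
    unfolding wedge_sum_right sum_fun_apply by (simp add: sum_distrib_left)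
qed

lemma sum_coordinates:
  "(\<Sum>B\<in>\<B>. \<Sum>j\<le>len B. f (b (lead B + j))) = (\<Sum>u\<in>Basis. f u)"
proof -
  have "(\<Sum>B\<in>\<B>. \<Sum>j\<le>len B. f (b (lead B + j))) = (\<Sum>(B, j)\<in>(SIGMA B:\<B>. {..len B}). f (b (lead B + j)))"
    using finite_blocks by (subst sum.Sigma) auto
  also have "\<dots> = (\<Sum>\<mu><N. f (b \<mu>))"
    using sum.reindex_bij_betw[OF bij_position, of "\<lambda>\<mu>. f (b \<mu>)"] by (simp add: case_prod_unfold)
  also have "\<dots> = (\<Sum>u\<in>Basis. f u)"
    by (rule sum.reindex_bij_betw[OF bij_coordinate])
  finally show ?thesis .
qed

section \<open>The kernel of a block decomposition and its integral\<close>

definition kernel_coeff :: "'v \<Rightarrow> 'i \<Rightarrow> nat \<Rightarrow> 'a" where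
  "kernel_coeff x B j = (x \<bullet> b (lead B + j)) *\<^sub>R 1 + (x \<bullet> b (lead B)) *\<^sub>R U B j"

definition kernel :: "'v \<Rightarrow> 'a form" where
  "kernel x = fscale (of_real (inverse (real N * measure lborel (ball (0::'v) 1)) / norm x ^ N))
     (block_form (kernel_coeff x))"

text \<open>Completing the sum over \<open>j \<ge> 1\<close> by \<open>- \<Sum> (U B j)\<^sup>2 = 1\<close> recovers the leading term of the Euler field.\<close>
lemma kernel_coeff_sum:
  fixes D :: "'v \<Rightarrow> 'a"
  assumes B: "B \<in> \<B>"
  shows "(\<Sum>j=1..len B. kernel_coeff x B j * (D (b (lead B + j)) - U B j * D (b (lead B))))
    = (\<Sum>j\<le>len B. (x \<bullet> b (lead B + j)) *\<^sub>R D (b (lead B + j)))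
      + (\<Sum>j=1..len B. U B j * ((x \<bullet> b (lead B)) *\<^sub>R D (b (lead B + j)) - (x \<bullet> b (lead B + j)) *\<^sub>R D (b (lead B))))"
proof -
  define l where "l = b (lead B)"
  define c where "c = (\<lambda>j. b (lead B + j))"
  have split: "(\<Sum>j\<le>len B. f j) = f 0 + (\<Sum>j=1..len B. f j)" for f :: "nat \<Rightarrow> 'a"
    by (simp add: atMost_atLeast0 sum.atLeast_Suc_atMost)
  have "(\<Sum>j=1..len B. (U B j)\<^sup>2) = - 1"
    using sum_U_squares[OF B] unfolding split U_lead[OF B] by (simp add: eq_neg_iff_add_eq_0 add.commute)
  then have "(\<Sum>j=1..len B. (x \<bullet> l) *\<^sub>R ((U B j)\<^sup>2 * D l)) = - ((x \<bullet> l) *\<^sub>R D l)"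
    by (simp flip: scaleR_sum_right sum_distrib_right)
  moreover have "kernel_coeff x B j * (D (c j) - U B j * D l)
     = (x \<bullet> c j) *\<^sub>R D (c j) + U B j * ((x \<bullet> l) *\<^sub>R D (c j) - (x \<bullet> c j) *\<^sub>R D l)
       - (x \<bullet> l) *\<^sub>R ((U B j)\<^sup>2 * D l)" for j
    by (simp add: kernel_coeff_def c_def l_def algebra_simps power2_eq_square mult.assoc)
  ultimately show ?thesis
    unfolding split c_def[symmetric] l_def[symmetric]
    by (simp add: sum.distrib sum_subtractf c_def l_def)
qed

lemma kernel_linear: "linear (\<lambda>x. block_form (kernel_coeff x) I)"
proof -
  have lin: "linear (\<lambda>x. kernel_coeff x B j)" for B j
    unfolding kernel_coeff_def by (rule linearI) (simp_all add: inner_add_left algebra_simps)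
  have "linear (\<lambda>x. fscale ((- 1) ^ j * kernel_coeff x B j) \<alpha> J)" for B j \<alpha> J
    unfolding fscale_def mult.assoc
    by (intro linear_mult_left linearI)
      (simp_all add: linear_add[OF lin] linear_scale[OF lin] distrib_right)
  then show ?thesis
    unfolding block_form_def sum_fun_apply
    by (intro linear_compose_sum ballI linear_wedge_right) (simp_all add: sum_fun_apply linear_compose_sum)
qed

text \<open>Cut off to \<open>K\<close>, the numerator still grows at most linearly and has bounded
  support. The cut-off destroys continuity, but \<open>radial_kernel_integral\<close> asks only for
  Borel measurability.\<close>

lemma locally_integrable_kernel: "locally_integrable_form kernel"
  unfolding locally_integrable_form_def set_integrable_def
proof (intro allI impI)
  fix I and K :: "'v set" assume "compact K"
  define G where "G = (\<lambda>x. block_form (kernel_coeff x) I)"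
  define c where "c = inverse (real N * measure lborel (ball (0::'v) 1))"
  have "bounded_linear G"
    unfolding G_def by (simp add: kernel_linear linear_conv_bounded_linear[symmetric])
  then obtain C where C: "\<And>x. norm (G x) \<le> C * norm x"
    using bounded_linear.bounded by (metis mult.commute)
  have [measurable]: "K \<in> sets borel" using \<open>compact K\<close> by (simp add: borel_compact)
  have [measurable]: "G \<in> borel_measurable borel"
    using \<open>bounded_linear G\<close> by (intro borel_measurable_continuous_onI linear_continuous_on)
  obtain R where R: "\<And>x. x \<in> K \<Longrightarrow> norm x \<le> R"
    using compact_imp_bounded[OF \<open>compact K\<close>] by (auto simp: bounded_iff)
  have "integrable lborel (\<lambda>x. (indicator K x *\<^sub>R G x) /\<^sub>R norm x ^ DIM('v))"
  proof (rule radial_kernel_integral(1))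
    show "norm (indicator K x *\<^sub>R G x) \<le> C * norm x" for x
      using C[of x] order_trans[OF norm_ge_zero C[of x]] by (auto split: split_indicator)
    show "indicator K x *\<^sub>R G x = 0" if "norm x > R" for x
      using that R[of x] by (auto split: split_indicator)
  qed measurable
  then have "integrable lborel (\<lambda>x. c *\<^sub>R ((indicator K x *\<^sub>R G x) /\<^sub>R norm x ^ DIM('v)))"
    by (rule integrable_scaleR_right)
  also have "(\<lambda>x. c *\<^sub>R ((indicator K x *\<^sub>R G x) /\<^sub>R norm x ^ DIM('v))) = (\<lambda>x. indicator K x *\<^sub>R kernel x I)"
    by (simp add: fun_eq_iff kernel_def fscale_def scaleR_conv_of_real[symmetric] G_def c_def divide_inverse mult_ac
        flip: N_eq)
  finally show "integrable lborel (\<lambda>x. indicator K x *\<^sub>R kernel x I)" .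
qed

lemma form_integral_kernel:
  assumes "compactly_supported_C1 \<phi> \<phi>' R"
  shows "(- 1) ^ N * form_integral N (\<lambda>x. kernel x \<and>\<^sub>f
     (\<Sum>B\<in>\<B>. \<Sum>j=1..len B. fscale (\<phi>' x (b (lead B + j)) - U B j * \<phi>' x (b (lead B))) (dx (lead B + j))))
    = \<phi> 0"
proof -
  interpret compactly_supported_C1 \<phi> \<phi>' R by fact
  define V where "V = measure lborel (ball (0::'v) 1)"
  define c where "c = inverse (real N * V)"
  define rot where "rot = (\<lambda>B j x. ((x \<bullet> b (lead B)) *\<^sub>R \<phi>' x (b (lead B + j))
    - (x \<bullet> b (lead B + j)) *\<^sub>R \<phi>' x (b (lead B))) /\<^sub>R norm x ^ N)"
  have N: "N > 0" by (simp add: N_eq)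
  have V: "V > 0" unfolding V_def by (rule content_ball_pos) simp
  \<comment> \<open>Boundedness comes from finite dimension; the norm of the algebra is not assumed
    to be submultiplicative.\<close>
  have bl: "bounded_linear (\<lambda>y. u * y)" for u :: 'a
    by (simp add: linear_conv_bounded_linear[symmetric] linear_mult_left[OF linear_id, unfolded id_def])
  have integrand: "(kernel x \<and>\<^sub>f (\<Sum>B\<in>\<B>. \<Sum>j=1..len B.
        fscale (\<phi>' x (b (lead B + j)) - U B j * \<phi>' x (b (lead B))) (dx (lead B + j)))) {..<N}
      = (- 1) ^ (N - 1) * (c *\<^sub>R (\<phi>' x x /\<^sub>R norm x ^ N + (\<Sum>B\<in>\<B>. \<Sum>j=1..len B. U B j * rot B j x)))" for x
  proof -
    have "(\<Sum>B\<in>\<B>. \<Sum>j=1..len B. kernel_coeff x B j * (\<phi>' x (b (lead B + j)) - U B j * \<phi>' x (b (lead B))))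
      = (\<Sum>B\<in>\<B>. (\<Sum>j\<le>len B. (x \<bullet> b (lead B + j)) *\<^sub>R \<phi>' x (b (lead B + j)))
        + (\<Sum>j=1..len B. U B j * ((x \<bullet> b (lead B)) *\<^sub>R \<phi>' x (b (lead B + j))
          - (x \<bullet> b (lead B + j)) *\<^sub>R \<phi>' x (b (lead B)))))"
      by (intro sum.cong refl kernel_coeff_sum)
    also have "\<dots> = \<phi>' x x + (\<Sum>B\<in>\<B>. \<Sum>j=1..len B. U B j * ((x \<bullet> b (lead B)) *\<^sub>R \<phi>' x (b (lead B + j))
          - (x \<bullet> b (lead B + j)) *\<^sub>R \<phi>' x (b (lead B))))"
      unfolding sum.distrib sum_coordinates[of "\<lambda>u. (x \<bullet> u) *\<^sub>R \<phi>' x u"] derivative_expand[symmetric] ..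
    finally show ?thesis
      unfolding kernel_def block_form_wedge_top
      by (simp add: scaleR_conv_of_real[symmetric] rot_def scaleR_add_right scaleR_sum_right V_def c_def divide_inverse)
  qed
  have euler: "has_bochner_integral lborel (\<lambda>x. \<phi>' x x /\<^sub>R norm x ^ N) (- (N * V) *\<^sub>R \<phi> 0)"
    using integral_Euler by (simp add: has_bochner_integral_iff N_eq V_def)
  have "has_bochner_integral lborel (rot B j) 0" for B j
    unfolding rot_def N_eq by (simp add: has_bochner_integral_iff integrable_rotation integral_rotation)
  then have rot: "has_bochner_integral lborel (\<lambda>x. U B j * rot B j x) 0" for B j
    using has_bochner_integral_bounded_linear[OF bl[of "U B j"], of lborel "rot B j" 0] by simp
  have "has_bochner_integral lborel
      (\<lambda>x. (- 1) ^ (N - 1) * (c *\<^sub>R (\<phi>' x x /\<^sub>R norm x ^ N + (\<Sum>B\<in>\<B>. \<Sum>j=1..len B. U B j * rot B j x))))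
      ((- 1) ^ (N - 1) * (c *\<^sub>R (- (N * V) *\<^sub>R \<phi> 0 + (\<Sum>B\<in>\<B>. \<Sum>j=1..len B. 0))))"
    by (intro has_bochner_integral_bounded_linear[OF bl] has_bochner_integral_scaleR_right
        has_bochner_integral_add has_bochner_integral_sum euler rot)
  then have "(\<integral>x. (- 1) ^ (N - 1) * (c *\<^sub>R (\<phi>' x x /\<^sub>R norm x ^ N + (\<Sum>B\<in>\<B>. \<Sum>j=1..len B. U B j * rot B j x))) \<partial>lborel)
      = (- 1) ^ (N - 1) * (c *\<^sub>R (- (N * V) *\<^sub>R \<phi> 0))"
    unfolding sum.neutral_const add_0_right by (rule has_bochner_integral_integral_eq)
  \<comment> \<open>\<open>c\<close> cancels \<open>N * V\<close>, and the minus sign of the Euler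
    integral raises the exponent \<open>N - 1\<close> to \<open>N\<close>; the prefactor in the
    claim then squares the sign to \<open>1\<close>.\<close>
  also have "\<dots> = (- 1) ^ N * \<phi> 0"
  proof -
    have "c * (N * V) = 1" unfolding c_def using N V by (intro left_inverse) simp
    moreover have "(- 1) ^ N = - ((- 1) ^ (N - 1) :: 'a)" using N by (cases N) auto
    ultimately show ?thesis by simp
  qed
  finally show ?thesis
    unfolding form_integral_def integrand by (simp add: mult.assoc[symmetric] flip: power_add)
qed

end

section \<open>The coordinates of a superspace\<close>

lemma dbar_const_form:
  fixes \<phi> :: "'v::euclidean_space \<Rightarrow> 'a::{real_algebra_1, euclidean_space}"
  shows "dbar b n m p e q r s a (\<lambda>z. const_form (\<phi> z)) x =
     (\<Sum>i=1..n. \<Sum>j=1..p. fscale (frechet_derivative \<phi> (at x) (b (y_pos p i j))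
        - e j * frechet_derivative \<phi> (at x) (b (y_pos p i 0))) (dx (y_pos p i j)))
   + (\<Sum>i=1..m. \<Sum>k=1..r. \<Sum>t\<in>{s k + 1..<s (k + 1)}. fscale (frechet_derivative \<phi> (at x) (b (t_pos n p q i t))
         - a t * frechet_derivative \<phi> (at x) (b (t_pos n p q i (s k)))) (dx (t_pos n p q i t)))"
proof -
  have deriv: "form_deriv v (\<lambda>z. const_form (\<phi> z)) x = const_form (frechet_derivative \<phi> (at x) v)" for v
    by (rule ext) (simp add: form_deriv_def const_form_def)
  have "form_deriv v (\<lambda>z. const_form (\<phi> z)) x - fscale u (form_deriv w (\<lambda>z. const_form (\<phi> z)) x)
      = const_form (frechet_derivative \<phi> (at x) v - u * frechet_derivative \<phi> (at x) w)" for u v w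
    unfolding deriv by (rule ext) (simp add: fscale_def const_form_def)
  then show ?thesis
    by (simp add: dbar_def dx_wedge_const_form)
qed

section \<open>Decomposition of the coordinate positions into blocks\<close>

lemma ex_block:
  fixes s :: "nat \<Rightarrow> nat"
  assumes "s 1 \<le> l" "l < s (r + 1)"
  shows "\<exists>k\<in>{1..r}. s k \<le> l \<and> l < s (k + 1)"
  using assms(2)
proof (induction r)
  case (Suc r)
  show ?case
  proof (cases "l < s (r + 1)")
    case True
    with Suc.IH show ?thesis by auto
  next
    case False
    with Suc.prems show ?thesis by (intro bexI[of _ "Suc r"]) auto
  qed
qed (use assms(1) in simp)

text \<open>A telescoping sum. The inequality is proved in the same induction because subtraction of
  natural numbers is truncated.\<close>

lemma sum_block_lengths:
  fixes s :: "nat \<Rightarrow> nat"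
  assumes "\<And>k. k \<in> {1..r} \<Longrightarrow> s k < s (k + 1)"
  shows "s 1 \<le> s (r + 1)" "(\<Sum>k=1..r. s (k + 1) - s k) = s (r + 1) - s 1"
  using assms
proof (induction r)
  case (Suc r)
  { case 1
    then have "s 1 \<le> s (r + 1)" by (intro Suc.IH(1)) auto
    with 1[of "Suc r"] show ?case by simp
  next
    case 2
    then have "s 1 \<le> s (r + 1)" "(\<Sum>k=1..r. s (k + 1) - s k) = s (r + 1) - s 1"
      by (intro Suc.IH; simp)+
    with 2[of "Suc r"] show ?case by simp }
qed simp_all

text \<open>The even block of the variable \<open>y\<^sub>i\<close> has the index \<open>(i, 0)\<close>; the \<open>k\<close>-th block of \<open>\<theta>\<^sub>i\<close> has the index \<open>(i, k)\<close>.\<close>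

definition blocks :: "nat \<Rightarrow> nat \<Rightarrow> nat \<Rightarrow> (nat \<times> nat) set" where
  "blocks n m r = {1..n} \<times> {0} \<union> {1..m} \<times> {1..r}"

definition block_lead :: "nat \<Rightarrow> nat \<Rightarrow> nat \<Rightarrow> (nat \<Rightarrow> nat) \<Rightarrow> nat \<times> nat \<Rightarrow> nat" where
  "block_lead n p q s = (\<lambda>(i, k). if k = 0 then y_pos p i 0 else t_pos n p q i (s k))"

text \<open>The length counts the coordinates after the leading one: \<open>p\<close> for the
  \<open>p + 1\<close> coordinates of an even variable, and one less than the number of indices in
  an odd block.\<close>

definition block_len :: "nat \<Rightarrow> (nat \<Rightarrow> nat) \<Rightarrow> nat \<times> nat \<Rightarrow> nat" where
  "block_len p s = (\<lambda>(i, k). if k = 0 then p else s (k + 1) - s k - 1)"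

definition block_coeff :: "(nat \<Rightarrow> 'a) \<Rightarrow> (nat \<Rightarrow> nat) \<Rightarrow> (nat \<Rightarrow> 'a) \<Rightarrow> nat \<times> nat \<Rightarrow> nat \<Rightarrow> 'a" where
  "block_coeff e s a = (\<lambda>(i, k) j. if k = 0 then e j else a (s k + j))"

lemma sum_blocks:
  "(\<Sum>B\<in>blocks n m r. f B) = (\<Sum>i=1..n. f (i, 0)) + (\<Sum>i=1..m. \<Sum>k=1..r. f (i, k))"
proof -
  have "(\<Sum>B\<in>blocks n m r. f B) = (\<Sum>B\<in>{1..n} \<times> {0}. f B) + (\<Sum>B\<in>{1..m} \<times> {1..r}. f B)"
    unfolding blocks_def by (rule sum.union_disjoint) auto
  also have "(\<Sum>B\<in>{1..n} \<times> {0}. f B) = (\<Sum>i=1..n. f (i, 0))"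
    using sum.cartesian_product[of "\<lambda>i k. f (i, k)" "{0}" "{1..n}"] by (simp add: case_prod_unfold)
  also have "(\<Sum>B\<in>{1..m} \<times> {1..r}. f B) = (\<Sum>i=1..m. \<Sum>k=1..r. f (i, k))"
    using sum.cartesian_product[of "\<lambda>i k. f (i, k)" "{1..r}" "{1..m}"] by (simp add: case_prod_unfold)
  finally show ?thesis .
qed

context
  fixes \<Lambda> :: "nat \<Rightarrow> 'a::{real_algebra_1, euclidean_space} set"
    and e \<epsilon> a :: "nat \<Rightarrow> 'a"
    and n m p q r :: nat
    and s :: "nat \<Rightarrow> nat"
    and b :: "nat \<Rightarrow> 'v::euclidean_space"
  assumes A0: "condition_A0 \<Lambda> p e"
    and A1: "condition_A1 \<Lambda> e q \<epsilon> r s a"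
    and b: "bij_betw b {..<num_coords n m p q} (Basis :: 'v set)"
begin

lemma block_starts:
  shows "s 1 = 1" "s (r + 1) = q + 1"
    and s_step: "k \<in> {1..r} \<Longrightarrow> s k < s (k + 1)"
    and s_pos: "k \<in> {1..r} \<Longrightarrow> 1 \<le> s k"
proof -
  show 1: "s 1 = 1" and "s (r + 1) = q + 1" and step: "k \<in> {1..r} \<Longrightarrow> s k < s (k + 1)" for k
    using A1 by (auto simp: condition_A1_def)
  show "1 \<le> s k" if k: "k \<in> {1..r}"
  proof -
    have "s 1 \<le> s (k - 1 + 1)"
      using k by (intro sum_block_lengths(1) step) auto
    with k 1 show ?thesis by simp
  qed
qed

text \<open>\<open>t_pos\<close> contains the truncated difference \<open>l - 1\<close>, so the
  shift is additive because \<open>1 \<le> s k\<close>.\<close>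

lemma t_pos_block: "k \<in> {1..r} \<Longrightarrow> t_pos n p q i (s k + j) = t_pos n p q i (s k) + j"
  using s_pos[of k] by (simp add: t_pos_def)

lemma sum_odd_block:
  assumes "k \<in> {1..r}"
  shows "(\<Sum>j\<le>s (k + 1) - s k - 1. f (s k + j)) = (\<Sum>l\<in>{s k..<s (k + 1)}. f l)"
    and "(\<Sum>j=1..s (k + 1) - s k - 1. f (s k + j)) = (\<Sum>l\<in>{s k + 1..<s (k + 1)}. f l)"
  using s_step[OF assms]
  by (intro sum.reindex_bij_witness[of _ "\<lambda>l. l - s k" "\<lambda>j. s k + j"]; auto)+

text \<open>Bijectivity is obtained by counting: the pairs of a block and an offset are exactly as
  many as the positions, and every position is reached. Injectivity follows without comparing
  positions from different blocks.\<close>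

lemma coordinate_blocks:
  "coordinate_blocks (num_coords n m p q) (blocks n m r) (block_lead n p q s) (block_len p s)
     (block_coeff e s a) b"
proof
  let ?N = "num_coords n m p q"
  let ?S = "SIGMA B:blocks n m r. {..block_len p s B}"
  let ?pos = "\<lambda>(B, j). block_lead n p q s B + j"
  show fin: "finite (blocks n m r)" by (simp add: blocks_def)
  have "card ?S = (\<Sum>B\<in>blocks n m r. Suc (block_len p s B))"
    using fin by simp
  also have "\<dots> = n * (p + 1) + m * (\<Sum>k=1..r. s (k + 1) - s k)"
  proof -
    have "(\<Sum>k=1..r. Suc (block_len p s (i, k))) = (\<Sum>k=1..r. s (k + 1) - s k)" for i
    proof (rule sum.cong)
      fix k assume "k \<in> {1..r}"
      with s_step[OF this] show "Suc (block_len p s (i, k)) = s (k + 1) - s k"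
        by (simp add: block_len_def)
    qed simp
    then show ?thesis by (simp add: sum_blocks block_len_def)
  qed
  also have "\<dots> = ?N"
    using sum_block_lengths(2)[of r s] s_step block_starts(1,2) by (simp add: num_coords_def)
  finally have card: "card ?S = ?N" .
  have sub: "{..<?N} \<subseteq> ?pos ` ?S"
  proof
    fix \<mu> assume "\<mu> \<in> {..<?N}"
    then have \<mu>: "\<mu> < n * (p + 1) + m * q" by (simp add: num_coords_def)
    show "\<mu> \<in> ?pos ` ?S"
    proof (cases "\<mu> < n * (p + 1)")
      case True
      then have "\<mu> div (p + 1) < n" by (intro less_mult_imp_div_less)
      then have "((\<mu> div (p + 1) + 1, 0), \<mu> mod (p + 1)) \<in> ?S"
        by (auto simp: blocks_def block_len_def simp flip: less_Suc_eq_le)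
      moreover have "\<mu> = ?pos ((\<mu> div (p + 1) + 1, 0), \<mu> mod (p + 1))"
        by (simp add: block_lead_def y_pos_def del: mult_Suc_right)
      ultimately show ?thesis by (rule rev_image_eqI)
    next
      case False
      \<comment> \<open>Division of the offset \<open>\<rho>\<close> by \<open>q\<close> recovers
        the odd variable, and the remainder plus \<open>1\<close> is its coordinate index, which
        \<open>ex_block\<close> then places in a block.\<close>
      define \<rho> where "\<rho> = \<mu> - n * (p + 1)"
      have \<rho>: "\<rho> < m * q" using \<mu> False by (simp add: \<rho>_def)
      then have "q > 0" "\<rho> div q < m" by (auto intro: less_mult_imp_div_less gr0I)
      define l where "l = \<rho> mod q + 1"
      have "s 1 \<le> l" "l < s (r + 1)"
        using \<open>q > 0\<close> by (simp_all add: block_starts(1,2)[simplified] l_def)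
      then obtain k where k: "k \<in> {1..r}" "s k \<le> l" "l < s (k + 1)"
        using ex_block by blast
      have "((\<rho> div q + 1, k), l - s k) \<in> ?S"
        using k \<open>\<rho> div q < m\<close> by (auto simp: blocks_def block_len_def)
      moreover have "\<mu> = ?pos ((\<rho> div q + 1, k), l - s k)"
      proof -
        have "?pos ((\<rho> div q + 1, k), l - s k) = t_pos n p q (\<rho> div q + 1) l"
          using t_pos_block[OF k(1), of _ "l - s k"] k by (simp add: block_lead_def)
        also have "\<dots> = n * (p + 1) + (\<rho> div q * q + \<rho> mod q)"
          by (simp add: t_pos_def l_def)
        also have "\<dots> = \<mu>" using False by (simp add: \<rho>_def)
        finally show ?thesis by simp
      qed
      ultimately show ?thesis by (rule rev_image_eqI)
    qed
  qed
  have "finite ?S" using fin by auto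
  have eq: "{..<?N} = ?pos ` ?S"
    using card_image_le[OF \<open>finite ?S\<close>, of ?pos] card \<open>finite ?S\<close> by (intro card_seteq sub) auto
  moreover have "inj_on ?pos ?S"
    using \<open>finite ?S\<close> by (rule eq_card_imp_inj_on) (simp only: eq[symmetric] card card_lessThan)
  ultimately show "bij_betw ?pos ?S {..<?N}" by (simp add: bij_betw_def)
  show "bij_betw b {..<?N} Basis" by (rule b)
  show "block_coeff e s a B 0 = 1" if "B \<in> blocks n m r" for B
    using that A0 A1 by (auto simp: block_coeff_def blocks_def condition_A0_def condition_A1_def)
  show "(\<Sum>j\<le>block_len p s B. (block_coeff e s a B j)\<^sup>2) = 0" if B: "B \<in> blocks n m r" for B
  proof (cases "snd B = 0")
    case True
    then show ?thesis
      using A0 by (cases B) (simp add: block_coeff_def block_len_def condition_A0_def atMost_atLeast0)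
  next
    case False
    then obtain i k where ik: "B = (i, k)" "k \<in> {1..r}"
      using B by (auto simp: blocks_def)
    then show ?thesis
      using sum_odd_block(1)[OF ik(2), of "\<lambda>l. (a l)\<^sup>2"] A1
      by (simp add: block_coeff_def block_len_def condition_A1_def)
  qed
qed

interpretation coordinate_blocks "num_coords n m p q" "blocks n m r" "block_lead n p q s" "block_len p s"
  "block_coeff e s a" b
  by (rule coordinate_blocks)

section \<open>The operator and the kernel of the superspace in terms of blocks\<close>

lemma dbar_eq:
  "dbar b n m p e q r s a (\<lambda>z. const_form (\<phi> z)) x =
    (\<Sum>B\<in>blocks n m r. \<Sum>j=1..block_len p s B.
       fscale (frechet_derivative \<phi> (at x) (b (block_lead n p q s B + j))
         - block_coeff e s a B j * frechet_derivative \<phi> (at x) (b (block_lead n p q s B)))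
       (dx (block_lead n p q s B + j)))"
proof -
  have odd: "(\<Sum>t\<in>{s k + 1..<s (k + 1)}. fscale (frechet_derivative \<phi> (at x) (b (t_pos n p q i t))
         - a t * frechet_derivative \<phi> (at x) (b (t_pos n p q i (s k)))) (dx (t_pos n p q i t)))
    = (\<Sum>j=1..block_len p s (i, k).
       fscale (frechet_derivative \<phi> (at x) (b (block_lead n p q s (i, k) + j))
         - block_coeff e s a (i, k) j * frechet_derivative \<phi> (at x) (b (block_lead n p q s (i, k))))
       (dx (block_lead n p q s (i, k) + j)))" if "k \<in> {1..r}" for i k
    using that unfolding sum_odd_block(2)[OF that, symmetric]
    by (simp add: block_len_def block_lead_def block_coeff_def t_pos_block)
  show ?thesis
    unfolding dbar_const_form sum_blocks
    by (intro arg_cong2[of _ _ _ _ "(+)"] sum.cong refl odd)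
      (simp_all add: block_len_def block_lead_def block_coeff_def y_pos_def)
qed

text \<open>With \<open>l = s k + j\<close> the block sign has exponent \<open>j = l - s k\<close>,
  and only its parity matters. Stating the condition as a parity of \<open>\<sigma>\<close> on
  non-leading indices handles both sign conventions at once.\<close>

lemma Omega_eq_kernel:
  assumes \<sigma>: "\<And>k l. k \<in> {1..r} \<Longrightarrow> s k < l \<Longrightarrow> even (\<sigma> k l) \<longleftrightarrow> even (l - s k)"
  shows "Omega b n m p e q r s a \<sigma> x = kernel x"
proof -
  have e0: "e 0 = 1" using A0 by (simp add: condition_A0_def)
  have even: "dY p e i \<and>\<^sub>f (\<Sum>j=1..p. fscale ((- 1) ^ j *
        ((x \<bullet> b (y_pos p i j)) *\<^sub>R e 0 + (x \<bullet> b (y_pos p i 0)) *\<^sub>R e j))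
        (dx_omit (num_coords n m p q) (y_pos p i 0) (y_pos p i j)))
    = (\<Sum>j\<le>block_len p s (i, 0). fscale (block_coeff e s a (i, 0) j) (dx (block_lead n p q s (i, 0) + j)))
     \<and>\<^sub>f (\<Sum>j=1..block_len p s (i, 0). fscale ((- 1) ^ j * kernel_coeff x (i, 0) j)
          (dx_omit (num_coords n m p q) (block_lead n p q s (i, 0)) (block_lead n p q s (i, 0) + j)))" for i
    unfolding kernel_coeff_def
    by (simp add: dY_def block_len_def block_lead_def block_coeff_def y_pos_def e0 atMost_atLeast0)
  have odd: "dZ n p q s a k i \<and>\<^sub>f (\<Sum>l\<in>{s k + 1..<s (k + 1)}.
        fscale ((- 1) ^ \<sigma> k l * ((x \<bullet> b (t_pos n p q i l)) *\<^sub>R e 0 + (x \<bullet> b (t_pos n p q i (s k))) *\<^sub>R a l))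
        (dx_omit (num_coords n m p q) (t_pos n p q i (s k)) (t_pos n p q i l)))
    = (\<Sum>j\<le>block_len p s (i, k). fscale (block_coeff e s a (i, k) j) (dx (block_lead n p q s (i, k) + j)))
     \<and>\<^sub>f (\<Sum>j=1..block_len p s (i, k). fscale ((- 1) ^ j * kernel_coeff x (i, k) j)
          (dx_omit (num_coords n m p q) (block_lead n p q s (i, k)) (block_lead n p q s (i, k) + j)))"
    if k: "k \<in> {1..r}" for i k
  proof -
    have "(- 1) ^ \<sigma> k (s k + j) = ((- 1) ^ j :: 'a)" if "1 \<le> j" for j
      using \<sigma>[OF k, of "s k + j"] that by (simp add: minus_one_power_iff)
    then show ?thesis
      using k unfolding kernel_coeff_def dZ_def sum_odd_block[OF k, symmetric]
      by (intro arg_cong2[of _ _ _ _ wedge] sum.cong)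
        (simp_all add: block_len_def block_lead_def block_coeff_def t_pos_block e0)
  qed
  show ?thesis
    unfolding Omega_def kernel_def block_form_def sum_blocks Let_def
    by (intro arg_cong2[of _ _ _ _ fscale] arg_cong2[of _ _ _ _ "(+)"] sum.cong refl even odd)
qed

lemma fundamental_solution_Omega:
  assumes "\<And>k l. k \<in> {1..r} \<Longrightarrow> s k < l \<Longrightarrow> even (\<sigma> k l) \<longleftrightarrow> even (l - s k)"
  shows "fundamental_solution b n m p e q r s a (Omega b n m p e q r s a \<sigma>)"
proof -
  have Omega: "Omega b n m p e q r s a \<sigma> = kernel"
    by (rule ext) (rule Omega_eq_kernel[OF assms])
  have "(- 1) ^ num_coords n m p q * form_integral (num_coords n m p q)
      (\<lambda>x. kernel x \<and>\<^sub>f dbar b n m p e q r s a (\<lambda>z. const_form (\<phi> z)) x) = \<phi> 0"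
    if "test_function \<phi>" for \<phi> :: "'v \<Rightarrow> 'a"
  proof -
    from that obtain R where "compactly_supported_C1 \<phi> (\<lambda>x. frechet_derivative \<phi> (at x)) R"
      by (rule test_function_compactly_supported_C1)
    then show ?thesis
      unfolding dbar_eq by (rule form_integral_kernel)
  qed
  then show ?thesis
    unfolding fundamental_solution_def Omega using locally_integrable_kernel by blast
qed

end

theorem mainTheorem4:
  fixes \<Lambda> :: "nat \<Rightarrow> 'a::{real_algebra_1, euclidean_space} set"
    and e \<epsilon> a :: "nat \<Rightarrow> 'a"
    and n m p q r :: nat
    and s :: "nat \<Rightarrow> nat"
    and b :: "nat \<Rightarrow> 'v::euclidean_space"
  assumes "comm_superalgebra \<Lambda>"
    and "condition_A0 \<Lambda> p e"
    and "condition_A1 \<Lambda> e q \<epsilon> r s a"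
    and "bij_betw b {..<num_coords n m p q} (Basis :: 'v set)"
  shows "fundamental_solution b n m p e q r s a
           (Omega b n m p e q r s a (\<lambda>k l. l - s k)) \<and>
         ((\<forall>k\<in>{1..r}. odd (s k)) \<longrightarrow>
           fundamental_solution b n m p e q r s a
             (Omega b n m p e q r s a (\<lambda>k l. l - 1)))"
proof (intro conjI impI)
  show "fundamental_solution b n m p e q r s a (Omega b n m p e q r s a (\<lambda>k l. l - s k))"
    using assms(2-4) by (rule fundamental_solution_Omega) simp
  assume odd: "\<forall>k\<in>{1..r}. odd (s k)"
  show "fundamental_solution b n m p e q r s a (Omega b n m p e q r s a (\<lambda>k l. l - 1))"
    using assms(2-4)
  proof (rule fundamental_solution_Omega)
    fix k l assume "k \<in> {1..r}" "s k < l"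
    \<comment> \<open>The exponents \<open>l - 1\<close> and \<open>l - s k\<close> differ by
      \<open>s k - 1\<close>, which is even when \<open>s k\<close> is odd.\<close>
    with odd show "even (l - 1) \<longleftrightarrow> even (l - s k)"
      by (auto simp: even_diff_nat)
  qed
qed

end
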